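(* Let $N\ge2$, $1\le r\le N-1$, $m\ge2$ an integer, $\alpha=\begin{pmatrix}\alpha_{11}&\alpha_{12}\\\alpha_{21}&\alpha_{22}\end{pmatrix}\in\mathbb{C}^{N\times N}$ (independent of $\epsilon$). Let $$\beta_{m-1}=\sum_{i\ge0}\begin{pmatrix}A_{m-1,i}&B_{m-1,i}\\C_{m-1,i}&D_{m-1,i}\end{pmatrix}\epsilon^i,\qquad \beta_m=\begin{pmatrix}0&0\\C_{m,0}&D_{m,0}\end{pmatrix}+\sum_{i\ge1}\begin{pmatrix}A_{m,i}&B_{m,i}\\C_{m,i}&D_{m,i}\end{pmatrix}\epsilon^i$$ with $\det\beta_m=O(\epsilon^r)$ as $\epsilon\to0$, and define $\beta_{n}$, $n\ge m+1$, by $\beta_{n+1}=n\beta_n^{-1}-\beta_{n-1}-\beta_n-\alpha$. For $n=m+1,m+2,m+3$ denote by $\begin{pmatrix}A_{n,0}&B_{n,0}\\C_{n,0}&D_{n,0}\end{pmatrix}$ the coefficient of $\epsilon^0$ in the Laurent expansion of $\beta_n$ (whenever it is defined), and set $$Z_1=D_{m+1,0}+D_{m,0}^{-1}C_{m,0}B_{m+1,0},\quad Z_2=D_{m+2,0}+D_{m,0}^{-1}C_{m,0}B_{m+2,0},\quad Z_3=D_{m+3,0}.$$ Then: (1) If $\det D_{m,0}\neq0$, then $\det\beta_{m+1}=O(\epsilon^{-r})$ as $\epsilon\to0$ if and only if $\det Z_1\neq0$. (2) If $\det D_{m,0}\ne0$ and $\det Z_1\ne0$, then $\det\beta_{m+2}=O(\epsilon^{-r})$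 if and only if $\det Z_2\ne0$. (3) If $\det D_{m,0}\ne0$, $\det Z_1\ne0$ and $\det Z_2\ne0$, then $\det\beta_{m+3}=O(\epsilon^{r})$ if and only if $\det Z_3\neq0$. (4) If $\det D_{m,0}\ne0$, $\det Z_1\ne0$, $\det Z_2\ne0$ and $\det Z_3\ne0$, then generically $\det\beta_{m+4}=O(1)$ as $\epsilon\to0$.
   Context: Blocks: upper-left $r\times r$, upper-right $r\times(N-r)$, lower-left $(N-r)\times r$, lower-right $(N-r)\times(N-r)$. Expansions are asymptotic (formal) expansions in $\epsilon$; inverses are computed in the ring of such Laurent expansions. A condition $\det X=O(\epsilon^{k})$ is understood in the sense of exact order: $\det X=c\,\epsilon^{k}+O(\epsilon^{k+1})$ with $c\ne0$. "Generically" means: for all values of the parameters (the coefficients of the initial data and $\alpha$) except possibly those lying on finitely many algebraic subvarieties of the parameter space. *)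

theory Defs
  imports Complex_Main "HOL-Computational_Algebra.Formal_Laurent_Series"
    "Jordan_Normal_Form.Determinant"
begin

text \<open>Matrix inverse over a field via the adjugate (equals the true inverse when det is nonzero).\<close>
definition minv :: "'a::field mat \<Rightarrow> 'a mat" where
  "minv A = inverse (det A) \<cdot>\<^sub>m adj_mat A"

definition exact_order :: "complex fls \<Rightarrow> int \<Rightarrow> bool" where
  "exact_order x k \<longleftrightarrow> x \<noteq> 0 \<and> fls_subdegree x = k"

definition is_power_series :: "complex fls \<Rightarrow> bool" where
  "is_power_series x \<longleftrightarrow> (\<forall>k<0. fls_nth x k = 0)"

definition const_mat :: "complex mat \<Rightarrow> complex fls mat" where
  "const_mat A = map_mat fls_const A"

definition coeff0 :: "complex fls mat \<Rightarrow> complex mat" where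
  "coeff0 M = map_mat (\<lambda>x. fls_nth x 0) M"

definition blkB :: "nat \<Rightarrow> nat \<Rightarrow> 'a mat \<Rightarrow> 'a mat" where
  "blkB N r M = mat r (N - r) (\<lambda>(i,j). M $$ (i, r + j))"
definition blkC :: "nat \<Rightarrow> nat \<Rightarrow> 'a mat \<Rightarrow> 'a mat" where
  "blkC N r M = mat (N - r) r (\<lambda>(i,j). M $$ (r + i, j))"
definition blkD :: "nat \<Rightarrow> nat \<Rightarrow> 'a mat \<Rightarrow> 'a mat" where
  "blkD N r M = mat (N - r) (N - r) (\<lambda>(i,j). M $$ (r + i, r + j))"

text \<open>The recurrence: bpair k = (beta_(m-1+k), beta_(m+k)), with
  beta_(n+1) = n beta_n^(-1) - beta_(n-1) - beta_n - alpha.\<close>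
fun bpair :: "complex mat \<Rightarrow> complex fls mat \<Rightarrow> complex fls mat \<Rightarrow> nat \<Rightarrow> nat
    \<Rightarrow> complex fls mat \<times> complex fls mat" where
  "bpair \<alpha> b0 b1 m 0 = (b0, b1)"
| "bpair \<alpha> b0 b1 m (Suc k) =
     (let p = fst (bpair \<alpha> b0 b1 m k); q = snd (bpair \<alpha> b0 b1 m k)
      in (q, of_nat (m + k) \<cdot>\<^sub>m minv q - p - q - const_mat \<alpha>))"

text \<open>beta \<alpha> b0 b1 m n = beta_n for n \<ge> m-1, where b0 = beta_(m-1), b1 = beta_m.\<close>
definition beta :: "complex mat \<Rightarrow> complex fls mat \<Rightarrow> complex fls mat \<Rightarrow> nat \<Rightarrow> nat
    \<Rightarrow> complex fls mat" where
  "beta \<alpha> b0 b1 m n = fst (bpair \<alpha> b0 b1 m (n - (m - 1)))"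

definition admissible :: "nat \<Rightarrow> nat \<Rightarrow> complex mat \<Rightarrow> complex fls mat \<Rightarrow> complex fls mat \<Rightarrow> bool" where
  "admissible N r \<alpha> b0 b1 \<longleftrightarrow>
     \<alpha> \<in> carrier_mat N N \<and> b0 \<in> carrier_mat N N \<and> b1 \<in> carrier_mat N N \<and>
     (\<forall>i<N. \<forall>j<N. is_power_series (b0 $$ (i,j)) \<and> is_power_series (b1 $$ (i,j))) \<and>
     (\<forall>i<r. \<forall>j<N. fls_nth (b1 $$ (i,j)) 0 = 0) \<and>
     exact_order (det b1) (int r)"

datatype coord = Alpha nat nat | B0 nat nat nat | B1 nat nat nat

definition param :: "nat \<Rightarrow> complex mat \<Rightarrow> complex fls mat \<Rightarrow> complex fls mat \<Rightarrow> coord \<Rightarrow> complex" where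
  "param N \<alpha> b0 b1 v = (case v of
      Alpha i j \<Rightarrow> if i < N \<and> j < N then \<alpha> $$ (i,j) else 0
    | B0 i j k \<Rightarrow> if i < N \<and> j < N then fls_nth (b0 $$ (i,j)) (int k) else 0
    | B1 i j k \<Rightarrow> if i < N \<and> j < N then fls_nth (b1 $$ (i,j)) (int k) else 0)"

definition polyfun :: "((coord \<Rightarrow> complex) \<Rightarrow> complex) \<Rightarrow> bool" where
  "polyfun P \<longleftrightarrow> (\<exists>(c :: (coord \<Rightarrow> nat) \<Rightarrow> complex) (V :: coord set).
      finite V \<and> finite {e. c e \<noteq> 0} \<and> (\<forall>e. c e \<noteq> 0 \<longrightarrow> (\<forall>v. v \<notin> V \<longrightarrow> e v = 0)) \<and>
      (\<forall>x. P x = (\<Sum>e\<in>{e. c e \<noteq> 0}. c e * (\<Prod>v\<in>V. x v ^ e v))))"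

end

theory Submission
  imports Defs
begin

text \<open>
  Conjugating every \<open>\<beta>\<^sub>n\<close> by the constant shear \<open>T = (1 0; u 1)\<close> with
  \<open>u = D\<^sub>m\<^sub>,\<^sub>0\<^sup>-\<^sup>1 C\<^sub>m\<^sub>,\<^sub>0\<close> commutes with the recurrence, clears the lower left block of the constant
  term of \<open>\<beta>\<^sub>m\<close>, and turns the lower right constant blocks into \<open>Z\<^sub>1\<close>, \<open>Z\<^sub>2\<close>, \<open>Z\<^sub>3\<close>. After
  that only the upper left block is singular, and inversion exchanges the two shapes
  \<open>(\<epsilon> A, O(\<epsilon>); O(\<epsilon>), D)\<close> and \<open>(\<epsilon>\<^sup>-\<^sup>1 A, O(1); O(1), D)\<close>, inverting \<open>A\<close> and \<open>D\<close>. Along the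
  orbit the leading upper left blocks are \<open>A\<close>, \<open>m A\<^sup>-\<^sup>1\<close>, \<open>-m A\<^sup>-\<^sup>1\<close>, \<open>-((m+3)/m) A\<close>, and in
  \<open>\<beta>\<^sub>m\<^sub>+\<^sub>4\<close> the poles cancel. The recurrence telescopes to
  \<open>\<beta>\<^sub>n\<^sub>+\<^sub>1 = n \<beta>\<^sub>n\<^sup>-\<^sup>1 - (n-1) \<beta>\<^sub>n\<^sub>-\<^sub>1\<^sup>-\<^sup>1 + \<beta>\<^sub>n\<^sub>-\<^sub>2\<close>, which makes the last two steps immediate.

  For genericity, inverting a Laurent series of fixed exact order only divides by its leading
  coefficient, so the constant term of \<open>det \<beta>\<^sub>m\<^sub>+\<^sub>4\<close> is a quotient of polynomials in the parameters
  whose denominator does not vanish under the hypotheses; its numerator is the required polynomial.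
  It is not identically zero because of an explicit orbit of block scalar matrices.
\<close>

section \<open>Orders of Laurent series and power series matrices\<close>

text \<open>The summation window depends only on the lower bounds \<open>a\<close> and
  \<open>b\<close>, not on the actual orders of the factors. This uniformity is what later makes
  coefficients of products of parameter-dependent series finite sums over a fixed range.\<close>

lemma fls_nth_mult_bounded:
  fixes f g :: "'a::field fls"
  assumes "\<forall>k<a. fls_nth f k = 0" "\<forall>k<b. fls_nth g k = 0"
  shows "fls_nth (f * g) n = (\<Sum>i=a..n-b. fls_nth f i * fls_nth g (n - i))"
proof (cases "f = 0 \<or> g = 0")
  case False
  have a: "a \<le> fls_subdegree f" using assms(1) False by (intro fls_subdegree_geI) auto
  have b: "b \<le> fls_subdegree g" using assms(2) False by (intro fls_subdegree_geI) auto
  show ?thesis unfolding fls_times_nth(2)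
    by (rule sum.mono_neutral_left) (use a b in \<open>auto simp: not_le intro!: fls_eq0_below_subdegree\<close>)
qed auto

text \<open>A lower bound on the order replaces \<open>fls_subdegree\<close>: the zero series
  satisfies every bound, so sums and products need no separate case for zero.\<close>

definition order_ge :: "int \<Rightarrow> 'a::zero fls \<Rightarrow> bool" where
  "order_ge h x \<longleftrightarrow> (\<forall>k<h. fls_nth x k = 0)"

lemma order_ge_mono: "order_ge h x \<Longrightarrow> g \<le> h \<Longrightarrow> order_ge g x"
  by (auto simp: order_ge_def)

lemma order_ge_lead_zero: "order_ge h x \<Longrightarrow> fls_nth x h = 0 \<Longrightarrow> order_ge (h + 1) x"
  unfolding order_ge_def by (metis order_le_less zle_add1_eq_le)

lemma order_ge_const [simp]: "order_ge 0 (fls_const c)"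
  by (simp add: order_ge_def)

lemma order_ge_one [simp]: "order_ge 0 1"
  using order_ge_const[of 1] by (simp del: order_ge_const)

lemma order_ge_add: "order_ge h x \<Longrightarrow> order_ge h y \<Longrightarrow> order_ge h (x + y)"
  for x y :: "'a::monoid_add fls"
  by (simp add: order_ge_def)

lemma order_ge_diff: "order_ge h x \<Longrightarrow> order_ge h y \<Longrightarrow> order_ge h (x - y)"
  for x y :: "'a::group_add fls"
  by (simp add: order_ge_def)

lemma order_ge_sum: "(\<And>i. i \<in> I \<Longrightarrow> order_ge h (x i)) \<Longrightarrow> order_ge h (sum x I)"
  for x :: "'b \<Rightarrow> 'a::comm_monoid_add fls"
  by (simp add: order_ge_def fls_nth_sum)

lemma order_ge_mult:
  fixes x y :: "'a::field fls"
  assumes "order_ge a x" "order_ge b y"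
  shows "order_ge (a + b) (x * y)"
  using assms by (auto simp: order_ge_def fls_nth_mult_bounded[of a x b y])

lemma fls_nth_mult_lead:
  fixes x y :: "'a::field fls"
  assumes "order_ge a x" "order_ge b y"
  shows "fls_nth (x * y) (a + b) = fls_nth x a * fls_nth y b"
  using assms fls_nth_mult_bounded[of a x b y "a + b"] by (auto simp: order_ge_def)

lemma order_ge_prod:
  fixes x :: "'b \<Rightarrow> 'a::field fls"
  assumes "finite I" "\<And>i. i \<in> I \<Longrightarrow> order_ge 0 (x i)"
  shows "order_ge 0 (prod x I) \<and> fls_nth (prod x I) 0 = (\<Prod>i\<in>I. fls_nth (x i) 0)"
  using assms
proof (induction I rule: finite_induct)
  case (insert i I)
  then show ?case
    using order_ge_mult[of 0 "x i" 0 "prod x I"] fls_nth_mult_lead[of 0 "x i" 0 "prod x I"] by simp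
qed simp

lemma order_ge_shift_iff:
  fixes x :: "'a::field fls"
  shows "order_ge h (fls_shift k x) \<longleftrightarrow> order_ge (h + k) x"
  unfolding order_ge_def fls_shift_nth by (metis add.commute add_less_cancel_left diff_add_cancel)

text \<open>Splits exactness into a bound and the nonvanishing of one coefficient. Every determinant
  claim below is decided through that coefficient.\<close>

lemma exact_order_iff: "exact_order x k \<longleftrightarrow> order_ge k x \<and> fls_nth x k \<noteq> 0"
  unfolding exact_order_def order_ge_def
  by (metis fls_eq0_below_subdegree fls_subdegree_eqI fls_zero_nth nth_fls_subdegree_nonzero)

lemma order_ge_inverse:
  fixes x :: "complex fls"
  assumes "exact_order x k"
  shows "order_ge (- k) (inverse x)"
  using assms by (simp add: order_ge_def exact_order_def fls_inverse_subdegree)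

section \<open>Matrices over the power series ring and their constant terms\<close>

definition mat_ps :: "'a::zero fls mat \<Rightarrow> bool" where
  "mat_ps M \<longleftrightarrow> (\<forall>i<dim_row M. \<forall>j<dim_col M. order_ge 0 (M $$ (i,j)))"

lemma coeff0_carrier [simp]: "coeff0 M \<in> carrier_mat n k \<longleftrightarrow> M \<in> carrier_mat n k"
  by (simp add: coeff0_def)

lemma coeff0_dim [simp]: "dim_row (coeff0 M) = dim_row M" "dim_col (coeff0 M) = dim_col M"
  by (simp_all add: coeff0_def)

lemma coeff0_index: "i < dim_row M \<Longrightarrow> j < dim_col M \<Longrightarrow> coeff0 M $$ (i,j) = fls_nth (M $$ (i,j)) 0"
  by (simp add: coeff0_def)

text \<open>Evaluation at \<epsilon> = 0 is a ring homomorphism on power series, hence compatible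
  with matrix products; a pole in one factor would break this.\<close>

lemma mat_ps_mult:
  assumes "A \<in> carrier_mat n k" "B \<in> carrier_mat k l" "mat_ps A" "mat_ps B"
  shows "mat_ps (A * B)" "coeff0 (A * B) = coeff0 A * coeff0 B"
proof -
  have 1: "(A * B) $$ (i,j) = (\<Sum>t=0..<k. A $$ (i,t) * B $$ (t,j))" if "i < n" "j < l" for i j
    using assms that by (auto simp: scalar_prod_def)
  have 2: "order_ge 0 (A $$ (i,t) * B $$ (t,j))"
    "fls_nth (A $$ (i,t) * B $$ (t,j)) 0 = fls_nth (A $$ (i,t)) 0 * fls_nth (B $$ (t,j)) 0"
    if "i < n" "j < l" "t < k" for i j t
    using assms that order_ge_mult[of 0 "A $$ (i,t)" 0 "B $$ (t,j)"]
      fls_nth_mult_lead[of 0 "A $$ (i,t)" 0 "B $$ (t,j)"]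
    by (auto simp: mat_ps_def)
  show "mat_ps (A * B)"
    unfolding mat_ps_def using assms(1,2) 1 2(1) by (auto intro!: order_ge_sum)
  show "coeff0 (A * B) = coeff0 A * coeff0 B"
  proof (rule eq_matI)
    fix i j assume "i < dim_row (coeff0 A * coeff0 B)" "j < dim_col (coeff0 A * coeff0 B)"
    then have ij: "i < n" "j < l" using assms by auto
    have "(coeff0 A * coeff0 B) $$ (i,j) = (\<Sum>t=0..<k. fls_nth (A $$ (i,t)) 0 * fls_nth (B $$ (t,j)) 0)"
      using assms ij by (auto simp: scalar_prod_def coeff0_index intro!: sum.cong)
    then show "coeff0 (A * B) $$ (i,j) = (coeff0 A * coeff0 B) $$ (i,j)"
      using assms(1,2) ij by (simp add: coeff0_index 1 2 fls_nth_sum del: index_mult_mat(1))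
  qed (use assms in auto)
qed

lemma signof_eq_fls_const: "(signof p :: 'a::ring_1 fls) = fls_const (signof p)"
  by (cases "sign p = 1") (auto simp: sign_def)

text \<open>The Leibniz formula involves only sums and products of entries, so evaluation at
  \<epsilon> = 0 passes through it term by term.\<close>

lemma mat_ps_det:
  assumes "A \<in> carrier_mat n n" "mat_ps A"
  shows "order_ge 0 (det A)" "fls_nth (det A) 0 = det (coeff0 A)"
proof -
  have A: "order_ge 0 (A $$ (i,j))" if "i < n" "j < n" for i j
    using assms that by (auto simp: mat_ps_def)
  have *: "order_ge 0 (\<Prod>i=0..<n. A $$ (i, p i)) \<and>
     fls_nth (\<Prod>i=0..<n. A $$ (i, p i)) 0 = (\<Prod>i=0..<n. coeff0 A $$ (i, p i))"
    if "p permutes {0..<n}" for p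
  proof -
    have "i < n \<Longrightarrow> p i < n" for i using permutes_in_image[OF that, of i] by auto
    moreover from this have "(\<Prod>i=0..<n. coeff0 A $$ (i, p i)) = (\<Prod>i=0..<n. fls_nth (A $$ (i, p i)) 0)"
      using assms(1) by (intro prod.cong) (auto simp: coeff0_index)
    ultimately show ?thesis
      using order_ge_prod[of "{0..<n}" "\<lambda>i. A $$ (i, p i)"] A by simp
  qed
  show "order_ge 0 (det A)"
    unfolding det_def'[OF assms(1)] signof_eq_fls_const
  proof (rule order_ge_sum, goal_cases)
    case (1 p)
    then show ?case
      using order_ge_mult[of 0 "fls_const (signof p)" 0 "\<Prod>i=0..<n. A $$ (i, p i)"] * by simp
  qed
  show "fls_nth (det A) 0 = det (coeff0 A)"
    unfolding det_def'[OF assms(1)] det_def'[of "coeff0 A" n, simplified, OF assms(1)]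
      signof_eq_fls_const fls_nth_sum
    using * by (intro sum.cong) auto
qed

section \<open>Matrix inverses through the adjugate\<close>

lemma minv_carrier [simp]: "A \<in> carrier_mat n n \<Longrightarrow> minv A \<in> carrier_mat n n"
  using adj_mat(1)[of A n] by (simp add: minv_def)

lemma minv_mult:
  assumes "A \<in> carrier_mat n n" "det A \<noteq> 0"
  shows "A * minv A = 1\<^sub>m n" "minv A * A = 1\<^sub>m n"
proof -
  show "A * minv A = 1\<^sub>m n"
    unfolding minv_def using assms adj_mat[OF assms(1)] by (subst mult_smult_distrib) (auto simp: intro!: eq_matI)
  show "minv A * A = 1\<^sub>m n"
    unfolding minv_def using assms adj_mat[OF assms(1)] by (subst mult_smult_assoc_mat) (auto simp: intro!: eq_matI)
qed

text \<open>A one-sided inverse suffices: multiplicativity of \<open>det\<close> gives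
  invertibility, and associativity identifies the inverse. Explicit inverses are recognised this way
  throughout.\<close>

lemma minv_unique:
  fixes A :: "'a::field mat"
  assumes "A \<in> carrier_mat n n" "B \<in> carrier_mat n n" "A * B = 1\<^sub>m n"
  shows "det A \<noteq> 0" "minv A = B"
proof -
  have "det A * det B = 1" using det_mult[OF assms(1,2)] assms(3) by simp
  then show d: "det A \<noteq> 0" by auto
  have "minv A * A * B = minv A * (A * B)"
    by (rule assoc_mult_mat[of _ n n _ n _ n]) (use assms in auto)
  then show "minv A = B"
    using minv_mult[OF assms(1) d] assms right_mult_one_mat[of "minv A" n n] by simp
qed

text \<open>The determinant is a power series with nonzero constant term, hence a unit of the power
  series ring, and the adjugate is polynomial in the entries. The constant terms are then inverse to
  each other because evaluation is multiplicative.\<close>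

lemma mat_ps_minv:
  fixes M :: "complex fls mat"
  assumes M: "M \<in> carrier_mat n n" "mat_ps M" and d: "det (coeff0 M) \<noteq> 0"
  shows "mat_ps (minv M)" "coeff0 M * coeff0 (minv M) = 1\<^sub>m n" "coeff0 (minv M) * coeff0 M = 1\<^sub>m n"
proof -
  have "exact_order (det M) 0" using mat_ps_det[OF M] d by (simp add: exact_order_iff)
  then have i: "order_ge 0 (inverse (det M))" and nz: "det M \<noteq> 0"
    using order_ge_inverse[of _ 0] by (auto simp: exact_order_def)
  have co: "order_ge 0 (cofactor M i j)" if "i < n" "j < n" for i j
  proof -
    have "mat_ps (mat_delete M i j)"
      using M that unfolding mat_ps_def mat_delete_def by auto
    moreover have "mat_delete M i j \<in> carrier_mat (n - 1) (n - 1)" using mat_delete_carrier M(1) .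
    ultimately have "order_ge 0 (det (mat_delete M i j))" using mat_ps_det(1) by blast
    moreover have "(-1 :: complex fls) ^ (i + j) = fls_const ((-1) ^ (i + j))"
      by (cases "even (i + j)") auto
    ultimately show ?thesis
      using order_ge_mult[of 0 "(-1) ^ (i + j)" 0 "det (mat_delete M i j)"] by (simp add: cofactor_def)
  qed
  show ps: "mat_ps (minv M)"
    unfolding mat_ps_def minv_def adj_mat_def using M(1) co order_ge_mult[OF i, of 0] by auto
  have one: "coeff0 (1\<^sub>m n) = 1\<^sub>m n" by (auto simp: coeff0_def)
  show "coeff0 M * coeff0 (minv M) = 1\<^sub>m n"
    using mat_ps_mult(2)[of M n n "minv M" n] M ps minv_mult[OF M(1) nz] one by simp
  show "coeff0 (minv M) * coeff0 M = 1\<^sub>m n"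
    using mat_ps_mult(2)[of "minv M" n n "M" n] M ps minv_mult[OF M(1) nz] one by simp
qed

section \<open>Block matrices of graded order\<close>

definition blkA :: "nat \<Rightarrow> 'a mat \<Rightarrow> 'a mat" where
  "blkA r M = mat r r (\<lambda>(i,j). M $$ (i, j))"

lemma blk_carrier [simp]:
  "blkA r M \<in> carrier_mat r r" "blkB N r M \<in> carrier_mat r (N - r)"
  "blkC N r M \<in> carrier_mat (N - r) r" "blkD N r M \<in> carrier_mat (N - r) (N - r)"
  by (simp_all add: blkA_def blkB_def blkC_def blkD_def)

lemma blk_split:
  assumes "M \<in> carrier_mat N N" "r \<le> N"
  shows "M = four_block_mat (blkA r M) (blkB N r M) (blkC N r M) (blkD N r M)"
  using assms by (intro eq_matI) (auto simp: blkA_def blkB_def blkC_def blkD_def)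

lemma blk_four_block:
  assumes "A \<in> carrier_mat r r" "B \<in> carrier_mat r (N - r)"
    "C \<in> carrier_mat (N - r) r" "D \<in> carrier_mat (N - r) (N - r)"
  shows "blkA r (four_block_mat A B C D) = A" "blkB N r (four_block_mat A B C D) = B"
    "blkC N r (four_block_mat A B C D) = C" "blkD N r (four_block_mat A B C D) = D"
  using assms by (auto intro!: eq_matI simp: blkA_def blkB_def blkC_def blkD_def)

lemma blk_mult:
  assumes "M \<in> carrier_mat N N" "V \<in> carrier_mat N N" "r \<le> N"
  shows "blkA r (M * V) = blkA r M * blkA r V + blkB N r M * blkC N r V"
    "blkB N r (M * V) = blkA r M * blkB N r V + blkB N r M * blkD N r V"
    "blkC N r (M * V) = blkC N r M * blkA r V + blkD N r M * blkC N r V"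
    "blkD N r (M * V) = blkC N r M * blkB N r V + blkD N r M * blkD N r V"
proof -
  have "M * V = four_block_mat (blkA r M * blkA r V + blkB N r M * blkC N r V)
     (blkA r M * blkB N r V + blkB N r M * blkD N r V)
     (blkC N r M * blkA r V + blkD N r M * blkC N r V)
     (blkC N r M * blkB N r V + blkD N r M * blkD N r V)"
    by (subst blk_split[OF assms(1,3)], subst blk_split[OF assms(2,3)], rule mult_four_block_mat[of _ r r _ "N - r" _ "N - r" _ _ r _ "N - r"]) auto
  moreover have "blkA r M * blkA r V + blkB N r M * blkC N r V \<in> carrier_mat r r"
    "blkA r M * blkB N r V + blkB N r M * blkD N r V \<in> carrier_mat r (N - r)"
    "blkC N r M * blkA r V + blkD N r M * blkC N r V \<in> carrier_mat (N - r) r"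
    "blkC N r M * blkB N r V + blkD N r M * blkD N r V \<in> carrier_mat (N - r) (N - r)"
    by (auto intro!: add_carrier_mat mult_carrier_mat[of _ _ "N - r"])
  note blk_four_block[OF this]
  ultimately show "blkA r (M * V) = blkA r M * blkA r V + blkB N r M * blkC N r V"
    "blkB N r (M * V) = blkA r M * blkB N r V + blkB N r M * blkD N r V"
    "blkC N r (M * V) = blkC N r M * blkA r V + blkD N r M * blkC N r V"
    "blkD N r (M * V) = blkC N r M * blkB N r V + blkD N r M * blkD N r V"
    by simp_all
qed

lemma blk_one:
  assumes "r \<le> N"
  shows "blkA r (1\<^sub>m N) = 1\<^sub>m r" "blkB N r (1\<^sub>m N) = 0\<^sub>m r (N - r)" "blkC N r (1\<^sub>m N) = 0\<^sub>m (N - r) r"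
  using assms by (auto intro!: eq_matI simp: blkA_def blkB_def blkC_def)

lemma left_cancel_mat:
  fixes A :: "'a::field mat"
  assumes "A \<in> carrier_mat n n" "A' \<in> carrier_mat n n" "A * A' = 1\<^sub>m n" "X \<in> carrier_mat n k"
  shows "A' * (A * X) = X"
  using assms mat_mult_left_right_inverse[OF assms(1-3)] by (simp flip: assoc_mult_mat[of A' n n A n X k])

lemma right_cancel_mat:
  fixes A :: "'a::field mat"
  assumes "A \<in> carrier_mat n n" "A' \<in> carrier_mat n n" "A * A' = 1\<^sub>m n" "X \<in> carrier_mat k n"
  shows "(X * A) * A' = X"
  using assms by (simp add: assoc_mult_mat[of X k n A n A' n])

text \<open>With the lower left block zero, the first block column of \<open>V * M = 1\<close> reads
  off the blocks of \<open>V\<close>; with the upper right block zero, the first block row of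
  \<open>M * V = 1\<close> does. In each case one of the two block products drops out and the upper
  left block of \<open>M\<close> can be cancelled.\<close>

lemma blk_inverse_triangular:
  fixes M V :: "'a::field mat"
  assumes MV: "M \<in> carrier_mat N N" "V \<in> carrier_mat N N" "M * V = 1\<^sub>m N" and r: "r \<le> N"
    and A': "A' \<in> carrier_mat r r" "blkA r M * A' = 1\<^sub>m r"
  shows "blkC N r M = 0\<^sub>m (N - r) r \<Longrightarrow> blkA r V = A' \<and> blkC N r V = 0\<^sub>m (N - r) r"
    and "blkB N r M = 0\<^sub>m r (N - r) \<Longrightarrow> blkA r V = A' \<and> blkB N r V = 0\<^sub>m r (N - r)"
proof -
  have VM: "V * M = 1\<^sub>m N" using mat_mult_left_right_inverse[OF MV] .
  have add_zero: "X * Y + 0\<^sub>m n l = X * Y" if "X \<in> carrier_mat n k" "Y \<in> carrier_mat k l"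
    for X Y :: "'a mat" and n k l
    using right_add_zero_mat[OF mult_carrier_mat[OF that]] .
  show "blkA r V = A' \<and> blkC N r V = 0\<^sub>m (N - r) r" if C: "blkC N r M = 0\<^sub>m (N - r) r"
  proof
    have "blkA r V * blkA r M = 1\<^sub>m r"
      using blk_mult(1)[OF MV(2,1) r] VM C r right_mult_zero_mat[of "blkB N r V" r "N - r" r]
        add_zero[of "blkA r V" r r "blkA r M" r] by (simp add: blk_one)
    then show "blkA r V = A'"
      using right_cancel_mat[of "blkA r M" r A' "blkA r V" r] A' by simp
    have "blkC N r V * blkA r M = 0\<^sub>m (N - r) r"
      using blk_mult(3)[OF MV(2,1) r] VM C r right_mult_zero_mat[of "blkD N r V" "N - r" "N - r" r]
        add_zero[of "blkC N r V" "N - r" r "blkA r M" r] by (simp add: blk_one)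
    then show "blkC N r V = 0\<^sub>m (N - r) r"
      using right_cancel_mat[of "blkA r M" r A' "blkC N r V" "N - r"] A' by simp
  qed
  show "blkA r V = A' \<and> blkB N r V = 0\<^sub>m r (N - r)" if C: "blkB N r M = 0\<^sub>m r (N - r)"
  proof
    have "blkA r M * blkA r V = 1\<^sub>m r"
      using blk_mult(1)[OF MV(1,2) r] MV(3) C r left_mult_zero_mat[of "blkC N r V" "N - r" r r]
        add_zero[of "blkA r M" r r "blkA r V" r] by (simp add: blk_one)
    then show "blkA r V = A'"
      using left_cancel_mat[of "blkA r M" r A' "blkA r V" r] A' by simp
    have "blkA r M * blkB N r V = 0\<^sub>m r (N - r)"
      using blk_mult(2)[OF MV(1,2) r] MV(3) C r left_mult_zero_mat[of "blkD N r V" "N - r" "N - r" r]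
        add_zero[of "blkA r M" r r "blkB N r V" "N - r"] by (simp add: blk_one)
    then show "blkB N r V = 0\<^sub>m r (N - r)"
      using left_cancel_mat[of "blkA r M" r A' "blkB N r V" "N - r"] A' by simp
  qed
qed

text \<open>
  The exponents \<open>e = 1\<close> and \<open>e = -1\<close> give the two shapes exchanged by inversion; \<open>max 0 e\<close> is the
  order of the off-diagonal blocks.
\<close>
definition graded :: "int \<Rightarrow> nat \<Rightarrow> nat \<Rightarrow> complex fls mat \<Rightarrow> complex mat \<Rightarrow> bool" where
  "graded e N r \<beta> A \<longleftrightarrow> r \<le> N \<and> \<beta> \<in> carrier_mat N N \<and> A \<in> carrier_mat r r \<and>
     (\<forall>i<N. \<forall>j<N. order_ge (if i < r \<and> j < r then e else if i < r \<or> j < r then max 0 e else 0) (\<beta> $$ (i,j))) \<and>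
     (\<forall>i<r. \<forall>j<r. fls_nth (\<beta> $$ (i,j)) e = A $$ (i,j))"

lemma graded_order:
  assumes "graded e N r \<beta> A" "i < N" "j < N"
  shows "order_ge (if i < r \<and> j < r then e else if i < r \<or> j < r then max 0 e else 0) (\<beta> $$ (i,j))"
  using assms unfolding graded_def by blast

section \<open>Determinant and inverse of graded matrices by row scaling\<close>

definition row_scale :: "nat \<Rightarrow> nat \<Rightarrow> int \<Rightarrow> complex fls mat" where
  "row_scale N r k = mat_diag N (\<lambda>i. if i < r then fls_X_intpow k else 1)"

lemma row_scale_carrier [simp]: "row_scale N r k \<in> carrier_mat N N"
  by (simp add: row_scale_def)

lemma det_mat_diag: "det (mat_diag n f) = (\<Prod>i<n. f i)" for f :: "nat \<Rightarrow> 'a::comm_ring_1"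
  by (subst det_upper_triangular[of _ n])
    (auto simp: mat_diag_def upper_triangular_def prod_list_diag_prod lessThan_atLeast0)

lemma prod_step_fun:
  fixes x y :: "'a::comm_monoid_mult"
  assumes "r \<le> N"
  shows "(\<Prod>i<N. if i < r then x else y) = x ^ r * y ^ (N - r)"
proof -
  have "{..<N} \<inter> {i. i < r} = {..<r}" "{..<N} \<inter> - {i. i < r} = {r..<N}" using assms by auto
  then show ?thesis by (simp add: prod.If_cases)
qed

lemma det_row_scale: "r \<le> N \<Longrightarrow> det (row_scale N r k) = fls_X_intpow (k * int r)"
  by (simp add: row_scale_def det_mat_diag prod_step_fun fls_shifted_pow mult.commute)

lemma row_scale_inverse: "row_scale N r k * row_scale N r (- k) = 1\<^sub>m N"
proof -
  have "row_scale N r k * row_scale N r (- k) = mat_diag N (\<lambda>x. 1)"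
    unfolding row_scale_def mat_diag_diag
    by (rule arg_cong[of _ _ "mat_diag N"]) (auto simp: fls_X_intpow_times_conv_shift)
  then show ?thesis by simp
qed

lemma row_scale_mult:
  assumes "M \<in> carrier_mat N N" "i < N" "j < N"
  shows "(row_scale N r k * M) $$ (i,j) = (if i < r then fls_shift (- k) (M $$ (i,j)) else M $$ (i,j))"
    and "(M * row_scale N r k) $$ (i,j) = (if j < r then fls_shift (- k) (M $$ (i,j)) else M $$ (i,j))"
  using assms mat_diag_mult_left[OF assms(1)] mat_diag_mult_right[OF assms(1)]
  by (simp_all add: row_scale_def fls_X_intpow_times_conv_shift)

text \<open>Multiplying the first \<open>r\<close> rows by \<epsilon> to the power
  \<open>- e\<close> removes the zero or pole. For \<open>e = 1\<close> the lower left block keeps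
  order at least 1, for \<open>e = -1\<close> the upper right block acquires it; either way the
  constant term is block triangular with diagonal blocks \<open>A\<close> and the constant term of
  the lower right block.\<close>

lemma graded_scaled:
  assumes g: "graded e N r \<beta> A" and e: "e = 1 \<or> e = -1"
  defines "M \<equiv> row_scale N r (- e) * \<beta>"
  shows "M \<in> carrier_mat N N" "mat_ps M" "blkA r (coeff0 M) = A"
    "blkD N r (coeff0 M) = blkD N r (coeff0 \<beta>)"
    "e = 1 \<Longrightarrow> blkC N r (coeff0 M) = 0\<^sub>m (N - r) r"
    "e = -1 \<Longrightarrow> blkB N r (coeff0 M) = 0\<^sub>m r (N - r)"
    "det (coeff0 M) = det A * det (blkD N r (coeff0 \<beta>))"
proof -
  have b: "\<beta> \<in> carrier_mat N N" and r: "r \<le> N" and A: "A \<in> carrier_mat r r"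
    using g by (auto simp: graded_def)
  have od: "order_ge (if i < r \<and> j < r then e else if i < r \<or> j < r then max 0 e else 0) (\<beta> $$ (i,j))"
    if "i < N" "j < N" for i j using g that by (auto simp: graded_def)
  have nth: "fls_nth (\<beta> $$ (i,j)) e = A $$ (i,j)" if "i < r" "j < r" for i j
    using g that by (auto simp: graded_def)
  show M: "M \<in> carrier_mat N N" unfolding M_def using b by (rule mult_carrier_mat[OF row_scale_carrier])
  have Mi: "M $$ (i,j) = (if i < r then fls_shift e (\<beta> $$ (i,j)) else \<beta> $$ (i,j))"
    if "i < N" "j < N" for i j
    unfolding M_def using row_scale_mult(1)[OF b that] by simp
  have M0: "coeff0 M $$ (i,j) = fls_nth (M $$ (i,j)) 0" if "i < N" "j < N" for i j
    using M that by (simp add: coeff0_index)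
  show "mat_ps M"
    unfolding mat_ps_def
  proof (intro allI impI)
    fix i j assume "i < dim_row M" "j < dim_col M"
    then have "i < N" "j < N" using M by auto
    then show "order_ge 0 (M $$ (i,j))"
      using od[of i j] e by (auto simp: Mi order_ge_shift_iff elim: order_ge_mono split: if_splits)
  qed
  show bA: "blkA r (coeff0 M) = A"
    using A r nth by (intro eq_matI) (auto simp: blkA_def M0 Mi)
  show bD: "blkD N r (coeff0 M) = blkD N r (coeff0 \<beta>)"
    using b r by (intro eq_matI) (auto simp: blkD_def M0 Mi coeff0_index)
  show bC: "blkC N r (coeff0 M) = 0\<^sub>m (N - r) r" if "e = 1"
  proof (rule eq_matI)
    fix i j assume "i < dim_row (0\<^sub>m (N - r) r :: complex mat)" "j < dim_col (0\<^sub>m (N - r) r :: complex mat)"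
    then show "blkC N r (coeff0 M) $$ (i,j) = 0\<^sub>m (N - r) r $$ (i,j)"
      using od[of "r + i" j] that r by (simp add: blkC_def M0 Mi order_ge_def)
  qed (auto simp: blkC_def)
  show bB: "blkB N r (coeff0 M) = 0\<^sub>m r (N - r)" if "e = -1"
  proof (rule eq_matI)
    fix i j assume "i < dim_row (0\<^sub>m r (N - r) :: complex mat)" "j < dim_col (0\<^sub>m r (N - r) :: complex mat)"
    then show "blkB N r (coeff0 M) $$ (i,j) = 0\<^sub>m r (N - r) $$ (i,j)"
      using od[of i "r + j"] that r by (simp add: blkB_def M0 Mi order_ge_def)
  qed (auto simp: blkB_def)
  have s: "coeff0 M = four_block_mat A (blkB N r (coeff0 M)) (blkC N r (coeff0 M)) (blkD N r (coeff0 \<beta>))"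
    using blk_split[of "coeff0 M" N r] M r bA bD by simp
  show "det (coeff0 M) = det A * det (blkD N r (coeff0 \<beta>))"
  proof (cases "e = 1")
    case True
    show ?thesis by (subst s, rule det_four_block_mat_lower_left_zero[OF A _ bC[OF True]]) auto
  next
    case False
    then have "e = -1" using e by auto
    then show ?thesis by (subst s, intro det_four_block_mat_upper_right_zero[OF A bB]) auto
  qed
qed

text \<open>The scaling shifts the determinant by exactly \<open>e * int r\<close>, so the
  coefficient in question is the constant term of the scaled determinant, which factors over the two
  diagonal blocks.\<close>

lemma graded_det:
  assumes g: "graded e N r \<beta> A" and e: "e = 1 \<or> e = -1"
  shows "exact_order (det \<beta>) (e * int r) \<longleftrightarrow> det A \<noteq> 0 \<and> det (blkD N r (coeff0 \<beta>)) \<noteq> 0"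
proof -
  define M where "M = row_scale N r (- e) * \<beta>"
  note M = graded_scaled[OF g e, folded M_def]
  have "\<beta> \<in> carrier_mat N N" "r \<le> N" using g by (auto simp: graded_def)
  then have "det M = fls_shift (e * int r) (det \<beta>)"
    unfolding M_def by (subst det_mult[of _ N]) (auto simp: det_row_scale fls_shifted_times_simps)
  then show ?thesis
    using mat_ps_det[OF M(1,2)] M(7) by (auto simp: exact_order_iff order_ge_shift_iff)
qed

text \<open>The scaled matrix \<open>M\<close> inverts within power series, and its inverse has a
  constant term of the same triangular shape. Undoing the scaling multiplies the first
  \<open>r\<close> columns, not rows, of that inverse; together with the vanishing off-diagonal
  block this produces the opposite shape.\<close>

lemma graded_minv:
  assumes g: "graded e N r \<beta> A" and e: "e = 1 \<or> e = -1"
    and A': "A' \<in> carrier_mat r r" "A * A' = 1\<^sub>m r" and D: "det (blkD N r (coeff0 \<beta>)) \<noteq> 0"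
  shows "graded (- e) N r (minv \<beta>) A'" "det \<beta> \<noteq> 0"
proof -
  have b: "\<beta> \<in> carrier_mat N N" and r: "r \<le> N" and A: "A \<in> carrier_mat r r"
    using g by (auto simp: graded_def)
  define M where "M = row_scale N r (- e) * \<beta>"
  note M = graded_scaled[OF g e, folded M_def]
  have "det A \<noteq> 0" using minv_unique(1)[OF A A'] .
  then have "det (coeff0 M) \<noteq> 0" using M(7) D by simp
  note V = mat_ps_minv[OF M(1,2) this]
  define V where "V = minv M"
  have V_c: "V \<in> carrier_mat N N" using M(1) by (simp add: V_def)
  note V = V[folded V_def]
  have dM: "det M \<noteq> 0"
    using mat_ps_det(2)[OF M(1,2)] \<open>det (coeff0 M) \<noteq> 0\<close> by auto
  \<comment> \<open>Since \<open>\<beta> = row_scale N r e * M\<close>, the inverse carries the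
    opposite scaling on the right.\<close>
  have "\<beta> * (V * row_scale N r (- e)) = 1\<^sub>m N"
  proof -
    have "row_scale N r e * M = \<beta>"
      unfolding M_def using b row_scale_inverse[of N r e]
      by (subst assoc_mult_mat[symmetric, of _ N N _ N _ N]) auto
    then have "\<beta> * (V * row_scale N r (- e)) = (row_scale N r e * M) * (V * row_scale N r (- e))" by simp
    also have "\<dots> = row_scale N r e * (M * (V * row_scale N r (- e)))"
      using M(1) V_c by (intro assoc_mult_mat[of _ N N _ N _ N]) auto
    also have "M * (V * row_scale N r (- e)) = (M * V) * row_scale N r (- e)"
      using M(1) V_c by (intro assoc_mult_mat[symmetric, of _ N N _ N _ N]) auto
    also have "M * V = 1\<^sub>m N" unfolding V_def using minv_mult(1)[OF M(1) dM] .
    finally show ?thesis using row_scale_inverse[of N r e] left_mult_one_mat[of "row_scale N r (-e)" N N] by simp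
  qed
  note u = minv_unique[OF b _ this]
  then show "det \<beta> \<noteq> 0" using V_c by (meson mult_carrier_mat row_scale_carrier)
  have mi: "minv \<beta> = V * row_scale N r (- e)" using V_c by (meson mult_carrier_mat row_scale_carrier u)
  have Vp: "order_ge 0 (V $$ (i,j))" if "i < N" "j < N" for i j
    using V(1) V_c that by (auto simp: mat_ps_def)
  have V0: "coeff0 V $$ (i,j) = fls_nth (V $$ (i,j)) 0" if "i < N" "j < N" for i j
    using V_c that by (simp add: coeff0_index)
  note tri = blk_inverse_triangular[of "coeff0 M" N "coeff0 V" r A', simplified, OF M(1) V_c V(2) r A'(1), unfolded M(3), OF A'(2)]
  have VA: "blkA r (coeff0 V) = A'" using tri M(5,6) e by blast
  have VA': "fls_nth (V $$ (i,j)) 0 = A' $$ (i,j)" if "i < r" "j < r" for i j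
    using arg_cong[OF VA, of "\<lambda>X. X $$ (i,j)"] that r by (simp add: blkA_def V0)
  have VC: "order_ge 1 (V $$ (i,j))" if "e = 1" "r \<le> i" "i < N" "j < r" for i j
  proof -
    have "blkC N r (coeff0 V) $$ (i - r, j) = 0" using tri(1) M(5) that by simp
    then show ?thesis
      using that r order_ge_lead_zero[OF Vp, of i j] by (simp add: blkC_def V0)
  qed
  have VB: "order_ge 1 (V $$ (i,j))" if "e = -1" "r \<le> j" "j < N" "i < r" for i j
  proof -
    have "blkB N r (coeff0 V) $$ (i, j - r) = 0" using tri(2) M(6) that by simp
    then show ?thesis
      using that r order_ge_lead_zero[OF Vp, of i j] by (simp add: blkB_def V0)
  qed
  have mi': "minv \<beta> $$ (i,j) = (if j < r then fls_shift e (V $$ (i,j)) else V $$ (i,j))" if "i < N" "j < N" for i j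
    unfolding mi using row_scale_mult(2)[OF V_c that, of r "- e"] by simp
  show "graded (- e) N r (minv \<beta>) A'"
    unfolding graded_def
  proof (intro conjI allI impI)
    fix i j assume ij: "i < N" "j < N"
    show "order_ge (if i < r \<and> j < r then - e else if i < r \<or> j < r then max 0 (- e) else 0) (minv \<beta> $$ (i, j))"
      using e Vp[OF ij] VC[of i j] VB[of j i] ij unfolding mi'[OF ij] order_ge_shift_iff if_distrib[of "order_ge _"]
      by (auto simp: not_less)
  qed (use r b A' VA' in \<open>auto simp: mi'\<close>)
qed

section \<open>Linear combinations of graded matrices\<close>

lemma graded_smult:
  assumes "graded e N r \<beta> A"
  shows "graded e N r (of_nat n \<cdot>\<^sub>m \<beta>) (of_nat n \<cdot>\<^sub>m A)"
proof -
  have c: "\<beta> \<in> carrier_mat N N" "A \<in> carrier_mat r r" "r \<le> N"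
    using assms by (auto simp: graded_def)
  have idx: "(of_nat n \<cdot>\<^sub>m \<beta>) $$ (i,j) = of_nat n * \<beta> $$ (i,j)" if "i < N" "j < N" for i j
    using that c by auto
  show ?thesis
    unfolding graded_def
  proof (intro conjI allI impI)
    fix i j assume ij: "i < N" "j < N"
    show "order_ge (if i < r \<and> j < r then e else if i < r \<or> j < r then max 0 e else 0) ((of_nat n \<cdot>\<^sub>m \<beta>) $$ (i,j))"
      using assms ij unfolding idx[OF ij] graded_def by (auto simp: order_ge_def)
  next
    fix i j assume "i < r" "j < r"
    then show "fls_nth ((of_nat n \<cdot>\<^sub>m \<beta>) $$ (i,j)) e = (of_nat n \<cdot>\<^sub>m A) $$ (i,j)"
      using assms c idx[of i j] by (simp add: graded_def)
  qed (use c in auto)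
qed

lemma graded_diff:
  assumes "graded e N r \<beta> A" "graded e N r \<beta>' A'"
  shows "graded e N r (\<beta> - \<beta>') (A - A')"
proof -
  have c: "\<beta> \<in> carrier_mat N N" "A \<in> carrier_mat r r" "r \<le> N"
    "\<beta>' \<in> carrier_mat N N" "A' \<in> carrier_mat r r"
    using assms by (auto simp: graded_def)
  have idx: "(\<beta> - \<beta>') $$ (i,j) = \<beta> $$ (i,j) - \<beta>' $$ (i,j)" if "i < N" "j < N" for i j
    using that c by auto
  show ?thesis
    unfolding graded_def
  proof (intro conjI allI impI)
    fix i j assume ij: "i < N" "j < N"
    show "order_ge (if i < r \<and> j < r then e else if i < r \<or> j < r then max 0 e else 0) ((\<beta> - \<beta>') $$ (i,j))"
      using assms ij unfolding idx[OF ij] graded_def by (intro order_ge_diff) blast+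
  next
    fix i j assume "i < r" "j < r"
    then show "fls_nth ((\<beta> - \<beta>') $$ (i,j)) e = (A - A') $$ (i,j)"
      using assms c idx[of i j] by (simp add: graded_def)
  qed (use c in auto)
qed

lemma graded_add:
  assumes "graded e N r \<beta> A" "graded e N r \<beta>' A'"
  shows "graded e N r (\<beta> + \<beta>') (A + A')"
proof -
  have c: "\<beta> \<in> carrier_mat N N" "A \<in> carrier_mat r r" "r \<le> N"
    "\<beta>' \<in> carrier_mat N N" "A' \<in> carrier_mat r r"
    using assms by (auto simp: graded_def)
  have idx: "(\<beta> + \<beta>') $$ (i,j) = \<beta> $$ (i,j) + \<beta>' $$ (i,j)" if "i < N" "j < N" for i j
    using that c by auto
  show ?thesis
    unfolding graded_def
  proof (intro conjI allI impI)
    fix i j assume ij: "i < N" "j < N"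
    show "order_ge (if i < r \<and> j < r then e else if i < r \<or> j < r then max 0 e else 0) ((\<beta> + \<beta>') $$ (i,j))"
      using assms ij unfolding idx[OF ij] graded_def by (intro order_ge_add) blast+
  next
    fix i j assume "i < r" "j < r"
    then show "fls_nth ((\<beta> + \<beta>') $$ (i,j)) e = (A + A') $$ (i,j)"
      using assms c idx[of i j] by (simp add: graded_def)
  qed (use c in auto)
qed

text \<open>A power series matrix counts as polar shape with zero polar part, so it can be added to
  matrices with poles without changing their leading block.\<close>

lemma graded_of_ps:
  assumes "\<beta> \<in> carrier_mat N N" "mat_ps \<beta>" "r \<le> N"
  shows "graded (-1) N r \<beta> (0\<^sub>m r r)"
  using assms unfolding graded_def mat_ps_def by (auto intro: order_ge_mono) (auto simp: order_ge_def)

lemma ps_of_graded_1: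
  assumes "graded 1 N r \<beta> A"
  shows "\<beta> \<in> carrier_mat N N" "mat_ps \<beta>"
  using assms unfolding graded_def mat_ps_def by (auto intro: order_ge_mono split: if_splits) (metis order_ge_mono zero_le_one)

text \<open>In the shape for \<open>e = -1\<close> only the upper left block may have a pole, and
  only a simple one. Once its residue vanishes, no pole is left.\<close>

lemma ps_of_graded_zero:
  assumes "graded (-1) N r \<beta> (0\<^sub>m r r)"
  shows "\<beta> \<in> carrier_mat N N" "mat_ps \<beta>"
proof -
  show b: "\<beta> \<in> carrier_mat N N" using assms by (auto simp: graded_def)
  show "mat_ps \<beta>" unfolding mat_ps_def
  proof (intro allI impI)
    fix i j assume "i < dim_row \<beta>" "j < dim_col \<beta>"
    then have "i < N" "j < N" using b by auto
    then show "order_ge 0 (\<beta> $$ (i,j))"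
      using assms order_ge_lead_zero[of "-1" "\<beta> $$ (i,j)"] unfolding graded_def
      by (cases "i < r \<and> j < r") (auto split: if_splits)
  qed
qed

section \<open>Confinement of the singularity\<close>

lemma graded_cong: "graded e N r \<beta> A \<Longrightarrow> A = A' \<Longrightarrow> graded e N r \<beta> A'"
  by simp

lemma smult_mult_smult_one:
  fixes A A' :: "'a::field mat"
  assumes "A \<in> carrier_mat r r" "A' \<in> carrier_mat r r" "A * A' = 1\<^sub>m r" "a * b = 1"
  shows "(a \<cdot>\<^sub>m A) * (b \<cdot>\<^sub>m A') = 1\<^sub>m r"
  using assms by (auto simp: mult_smult_distrib[of _ r r] mult_smult_assoc_mat[of _ r r] mult.commute intro!: eq_matI)

text \<open>In the application \<open>R\<close> is the conjugate of \<alpha>, \<open>P\<close> and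
  \<open>Q\<close> are two consecutive iterates, \<open>Y - P - Q - R\<close> is the next one by the
  recurrence, and the left side is the one after that. Both \<open>Q\<close> and \<open>R\<close>
  cancel.\<close>

lemma telescope_mat:
  fixes X :: "'a::ab_group_add mat"
  assumes "X \<in> carrier_mat n k" "Y \<in> carrier_mat n k" "P \<in> carrier_mat n k"
    "Q \<in> carrier_mat n k" "R \<in> carrier_mat n k"
  shows "X - Q - (Y - P - Q - R) - R = X - Y + P"
  using assms by (intro eq_matI) auto

text \<open>The leading upper left block is followed through the recurrence. It stays a nonzero
  multiple of \<open>A\<close> or of its inverse, so \<open>graded_det\<close> reduces each
  determinant claim to the constant term of the lower right block.\<close>

lemma singularity_confinement:
  fixes g0 p al :: "complex fls mat" and m :: nat
  assumes m: "0 < m"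
    and g0: "graded 1 N r g0 A" "exact_order (det g0) (int r)"
    and p: "p \<in> carrier_mat N N" "mat_ps p"
    and al: "al \<in> carrier_mat N N" "mat_ps al"
    and g1: "g1 = of_nat m \<cdot>\<^sub>m minv g0 - p - g0 - al"
    and g2: "g2 = of_nat (m + 1) \<cdot>\<^sub>m minv g1 - g0 - g1 - al"
    and g3: "g3 = of_nat (m + 2) \<cdot>\<^sub>m minv g2 - g1 - g2 - al"
    and g4: "g4 = of_nat (m + 3) \<cdot>\<^sub>m minv g3 - g2 - g3 - al"
  defines "D \<equiv> \<lambda>g. det (blkD N r (coeff0 g))"
  shows "exact_order (det g1) (- int r) \<longleftrightarrow> D g1 \<noteq> 0"
    and "D g1 \<noteq> 0 \<Longrightarrow> exact_order (det g2) (- int r) \<longleftrightarrow> D g2 \<noteq> 0"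
    and "D g1 \<noteq> 0 \<Longrightarrow> D g2 \<noteq> 0 \<Longrightarrow> exact_order (det g3) (int r) \<longleftrightarrow> D g3 \<noteq> 0"
    and "D g1 \<noteq> 0 \<Longrightarrow> D g2 \<noteq> 0 \<Longrightarrow> blkB N r (coeff0 g3) = 0\<^sub>m r (N - r)"
    and "D g1 \<noteq> 0 \<Longrightarrow> D g2 \<noteq> 0 \<Longrightarrow> D g3 \<noteq> 0 \<Longrightarrow> g4 \<in> carrier_mat N N \<and> mat_ps g4"
proof -
  have A: "A \<in> carrier_mat r r" and r: "r \<le> N" and g0c: "g0 \<in> carrier_mat N N"
    using g0 by (auto simp: graded_def)
  \<comment> \<open>The exact order of \<open>det g0\<close> forces both diagonal blocks of the
    scaled constant term to be invertible.\<close>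
  have "det A \<noteq> 0" and D0: "D g0 \<noteq> 0"
    using graded_det[OF g0(1)] g0(2) by (auto simp: D_def)
  define A' where "A' = minv A"
  have A': "A' \<in> carrier_mat r r" "A * A' = 1\<^sub>m r"
    using A \<open>det A \<noteq> 0\<close> by (auto simp: A'_def minv_mult)
  have A'A: "A' * A = 1\<^sub>m r" using mat_mult_left_right_inverse[OF A A'] .
  note ps = graded_of_ps[OF _ _ r]
  have z: "0\<^sub>m r r \<in> carrier_mat r r" by simp
  have i0: "graded (-1) N r (minv g0) A'"
    using graded_minv[OF g0(1) _ A'] D0 by (simp add: D_def)
  \<comment> \<open>Only \<open>minv g0\<close> has a pole; \<open>p\<close>, \<open>g0\<close> and
    \<open>al\<close> are power series and contribute zero to the polar part.\<close>
  have G1: "graded (-1) N r g1 (of_nat m \<cdot>\<^sub>m A')"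
    unfolding g1
    by (rule graded_cong[OF graded_diff[OF graded_diff[OF graded_diff[OF graded_smult[OF i0]
        ps[OF p]] ps[OF ps_of_graded_1[OF g0(1)]]] ps[OF al]]])
      (use A'(1) in \<open>auto intro!: eq_matI\<close>)
  have A1: "of_nat m \<cdot>\<^sub>m A' * (inverse (of_nat m) \<cdot>\<^sub>m A) = 1\<^sub>m r"
    using smult_mult_smult_one[OF A'(1) A A'A] m by simp
  then have dA1: "det (of_nat m \<cdot>\<^sub>m A') \<noteq> 0"
    using minv_unique(1)[of "of_nat m \<cdot>\<^sub>m A'" r "inverse (of_nat m) \<cdot>\<^sub>m A"] A A' by simp
  show "exact_order (det g1) (- int r) \<longleftrightarrow> D g1 \<noteq> 0"
    using graded_det[OF G1] dA1 by (simp add: D_def)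

  have i1: "graded 1 N r (minv g1) (inverse (of_nat m) \<cdot>\<^sub>m A)" if "D g1 \<noteq> 0"
    using graded_minv(1)[OF G1 _ _ A1] A that by (simp add: D_def)
  \<comment> \<open>Here \<open>minv g1\<close> is regular, so the polar part comes from the term
    \<open>- g1\<close> alone.\<close>
  have G2: "graded (-1) N r g2 (- of_nat m \<cdot>\<^sub>m A')" if "D g1 \<noteq> 0"
    unfolding g2
    by (rule graded_cong[OF graded_diff[OF graded_diff[OF graded_diff[OF
        ps[OF ps_of_graded_1[OF graded_smult[OF i1[OF that]]]]
        ps[OF ps_of_graded_1[OF g0(1)]]] G1] ps[OF al]]])
      (use A'(1) in \<open>auto intro!: eq_matI\<close>)
  have A2: "- of_nat m \<cdot>\<^sub>m A' * (- inverse (of_nat m) \<cdot>\<^sub>m A) = 1\<^sub>m r"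
    using smult_mult_smult_one[OF A'(1) A A'A] m by simp
  then have dA2: "det (- of_nat m \<cdot>\<^sub>m A') \<noteq> 0"
    using minv_unique(1)[of "- of_nat m \<cdot>\<^sub>m A'" r "- inverse (of_nat m) \<cdot>\<^sub>m A"] A A' by simp
  show "exact_order (det g2) (- int r) \<longleftrightarrow> D g2 \<noteq> 0" if "D g1 \<noteq> 0"
    using graded_det[OF G2[OF that]] dA2 by (simp add: D_def)

  have c: "g1 \<in> carrier_mat N N" "minv g1 \<in> carrier_mat N N" using G1 by (auto simp: graded_def)
  \<comment> \<open>A difference takes its dimensions from the subtrahend, so the last term
    \<open>al\<close> alone determines the carrier.\<close>
  have "g2 \<in> carrier_mat N N" unfolding g2 by (rule minus_carrier_mat[OF al(1)])
  then have c2: "g2 \<in> carrier_mat N N" "minv g2 \<in> carrier_mat N N" by auto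
  have "g3 \<in> carrier_mat N N" unfolding g3 by (rule minus_carrier_mat[OF al(1)])
  then have c3: "g3 \<in> carrier_mat N N" "minv g3 \<in> carrier_mat N N" by auto
  have i2: "graded 1 N r (minv g2) (- inverse (of_nat m) \<cdot>\<^sub>m A)" if "D g1 \<noteq> 0" "D g2 \<noteq> 0"
    using graded_minv(1)[OF G2[OF that(1)] _ _ A2] A that by (simp add: D_def)
  \<comment> \<open>In the telescoped form every summand has the shape for \<open>e = 1\<close>; in
    the original form the poles of \<open>g1\<close> and \<open>g2\<close> would have to be
    cancelled against each other, together with the constant off-diagonal terms.\<close>
  have g3': "g3 = of_nat (m + 2) \<cdot>\<^sub>m minv g2 - of_nat (m + 1) \<cdot>\<^sub>m minv g1 + g0"
    unfolding g3 by (subst (2) g2, rule telescope_mat[of _ N N]) (use c c2 g0c al in auto)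
  \<comment> \<open>The coefficient of \<open>A\<close> is -(m+2)/m - (m+1)/m + 1 =
    -(m+3)/m.\<close>
  have G3: "graded 1 N r g3 (- (of_nat (m + 3) / of_nat m) \<cdot>\<^sub>m A)" if "D g1 \<noteq> 0" "D g2 \<noteq> 0"
    unfolding g3'
    by (rule graded_cong[OF graded_add[OF graded_diff[OF graded_smult[OF i2[OF that]]
        graded_smult[OF i1[OF that(1)]]] g0(1)]])
      (use A m in \<open>auto intro!: eq_matI simp: field_simps\<close>)
  have "(of_nat (m + 3) :: complex) \<noteq> 0" by (metis add_is_0 of_nat_eq_0_iff zero_neq_numeral)
  then have A3: "- (of_nat (m + 3) / of_nat m) \<cdot>\<^sub>m A * (- (of_nat m / of_nat (m + 3)) \<cdot>\<^sub>m A') = 1\<^sub>m r"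
    using m by (intro smult_mult_smult_one[OF A A'(1,2)]) (simp del: of_nat_add)
  have dA3: "det (- (of_nat (m + 3) / of_nat m) \<cdot>\<^sub>m A) \<noteq> 0"
    by (rule minv_unique(1)[OF _ _ A3]) (use A A' in auto)
  show "exact_order (det g3) (int r) \<longleftrightarrow> D g3 \<noteq> 0" if "D g1 \<noteq> 0" "D g2 \<noteq> 0"
    using graded_det[OF G3[OF that]] dA3 by (simp add: D_def)
  show "blkB N r (coeff0 g3) = 0\<^sub>m r (N - r)" if "D g1 \<noteq> 0" "D g2 \<noteq> 0"
  proof (rule eq_matI)
    fix i j assume "i < dim_row (0\<^sub>m r (N - r) :: complex mat)" "j < dim_col (0\<^sub>m r (N - r) :: complex mat)"
    then have ij: "i < r" "r + j < N" by auto
    then have "order_ge 1 (g3 $$ (i, r + j))"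
      using graded_order[OF G3[OF that], of i "r + j"] r by simp
    then show "blkB N r (coeff0 g3) $$ (i,j) = 0\<^sub>m r (N - r) $$ (i,j)"
      using ij r c3 by (simp add: blkB_def coeff0_index order_ge_def)
  qed (auto simp: blkB_def)

  have g4': "g4 = of_nat (m + 3) \<cdot>\<^sub>m minv g3 - of_nat (m + 2) \<cdot>\<^sub>m minv g2 + g1"
    unfolding g4 by (subst (2) g3, rule telescope_mat[of _ N N]) (use c c2 c3 al in auto)
  show "g4 \<in> carrier_mat N N \<and> mat_ps g4" if "D g1 \<noteq> 0" "D g2 \<noteq> 0" "D g3 \<noteq> 0"
  proof -
    have i3: "graded (-1) N r (minv g3) (- (of_nat m / of_nat (m + 3)) \<cdot>\<^sub>m A')"
      using graded_minv(1)[OF G3[OF that(1,2)] _ _ A3] A' that by (simp add: D_def)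
    \<comment> \<open>The factor \<open>m + 3\<close> turns the residue of \<open>minv g3\<close>
      into \<open>-m\<close> times \<open>A'\<close>, which cancels the residue of
      \<open>g1\<close>; \<open>minv g2\<close> is regular.\<close>
    have "graded (-1) N r g4 (0\<^sub>m r r)"
      unfolding g4'
      by (rule graded_cong[OF graded_add[OF graded_diff[OF graded_smult[OF i3]
          ps[OF ps_of_graded_1[OF graded_smult[OF i2[OF that(1,2)]]]]] G1]])
        (use A' \<open>(of_nat (m + 3) :: complex) \<noteq> 0\<close> in \<open>auto intro!: eq_matI simp del: of_nat_add\<close>)
    then show ?thesis using ps_of_graded_zero by blast
  qed
qed

section \<open>Constant matrices and conjugation\<close>

lemma const_mat_carrier [simp]: "const_mat M \<in> carrier_mat n k \<longleftrightarrow> M \<in> carrier_mat n k"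
  by (simp add: const_mat_def)

lemma mat_ps_const_mat [simp]: "mat_ps (const_mat M)"
  by (simp add: const_mat_def mat_ps_def)

lemma const_mat_one: "const_mat (1\<^sub>m n) = 1\<^sub>m n"
  by (auto simp: const_mat_def)

lemma const_mat_mult:
  assumes "A \<in> carrier_mat n k" "B \<in> carrier_mat k l"
  shows "const_mat (A * B) = const_mat A * const_mat B"
proof (rule eq_matI)
  fix i j assume "i < dim_row (const_mat A * const_mat B)" "j < dim_col (const_mat A * const_mat B)"
  then have "i < n" "j < l" using assms by (auto simp: const_mat_def)
  moreover have "fls_const (\<Sum>t\<in>T. f t) = (\<Sum>t\<in>T. fls_const (f t))" for T and f :: "nat \<Rightarrow> complex"
    by (rule fls_eqI) (simp add: fls_nth_sum)
  ultimately show "const_mat (A * B) $$ (i,j) = (const_mat A * const_mat B) $$ (i,j)"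
    using assms by (auto simp: const_mat_def scalar_prod_def intro!: sum.cong)
qed (use assms in \<open>auto simp: const_mat_def\<close>)

text \<open>A factor independent of \<epsilon> acts on each coefficient separately, so
  \<open>M\<close> may have poles. This is needed for the iterates with a pole, to which
  \<open>mat_ps_mult\<close> does not apply.\<close>

lemma coeff0_mult_const:
  assumes "A \<in> carrier_mat n k" "M \<in> carrier_mat k l"
  shows "coeff0 (const_mat A * M) = A * coeff0 M"
proof (rule eq_matI)
  fix i j assume "i < dim_row (A * coeff0 M)" "j < dim_col (A * coeff0 M)"
  then show "coeff0 (const_mat A * M) $$ (i,j) = (A * coeff0 M) $$ (i,j)"
    using assms by (auto simp: const_mat_def coeff0_def scalar_prod_def fls_nth_sum intro!: sum.cong)
qed (use assms in \<open>auto simp: const_mat_def\<close>)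

lemma coeff0_const_mult:
  assumes "A \<in> carrier_mat k l" "M \<in> carrier_mat n k"
  shows "coeff0 (M * const_mat A) = coeff0 M * A"
proof (rule eq_matI)
  fix i j assume "i < dim_row (coeff0 M * A)" "j < dim_col (coeff0 M * A)"
  then show "coeff0 (M * const_mat A) $$ (i,j) = (coeff0 M * A) $$ (i,j)"
    using assms by (auto simp: const_mat_def coeff0_def scalar_prod_def fls_nth_sum intro!: sum.cong)
qed (use assms in \<open>auto simp: const_mat_def\<close>)

definition conj_mat :: "'a::semiring_0 mat \<Rightarrow> 'a mat \<Rightarrow> 'a mat \<Rightarrow> 'a mat" where
  "conj_mat T T' M = T * M * T'"

lemma conj_mat_carrier [simp]:
  "T \<in> carrier_mat N N \<Longrightarrow> T' \<in> carrier_mat N N \<Longrightarrow> conj_mat T T' M \<in> carrier_mat N N"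
  by (auto simp: conj_mat_def)

lemma conj_mat_mult:
  fixes T :: "'a::ring_1 mat"
  assumes "T \<in> carrier_mat N N" "T' \<in> carrier_mat N N" "T' * T = 1\<^sub>m N"
    and "P \<in> carrier_mat N N" "Q \<in> carrier_mat N N"
  shows "conj_mat T T' P * conj_mat T T' Q = conj_mat T T' (P * Q)"
proof -
  have "conj_mat T T' P * conj_mat T T' Q = T * P * (T' * (T * Q * T'))"
    unfolding conj_mat_def using assms by (intro assoc_mult_mat[of _ N N _ N _ N]) auto
  also have "T' * (T * Q * T') = T' * (T * (Q * T'))"
    using assms by (simp add: assoc_mult_mat[of _ N N _ N _ N])
  also have "\<dots> = T' * T * (Q * T')"
    using assms by (intro assoc_mult_mat[symmetric, of _ N N _ N _ N]) auto
  also have "\<dots> = Q * T'"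
    using assms left_mult_one_mat[of "Q * T'" N N] by simp
  also have "T * P * (Q * T') = conj_mat T T' (P * Q)"
    unfolding conj_mat_def using assms by (simp add: assoc_mult_mat[of _ N N _ N _ N])
  finally show ?thesis .
qed

lemma det_conj_mat:
  fixes Q :: "'a::field mat"
  assumes T: "T \<in> carrier_mat N N" "T' \<in> carrier_mat N N" "T' * T = 1\<^sub>m N"
    and Q: "Q \<in> carrier_mat N N"
  shows "det (conj_mat T T' Q) = det Q"
proof -
  have "det T' * det T = 1" using det_mult[OF T(2,1)] T(3) by simp
  then show ?thesis
    using T Q by (simp add: conj_mat_def det_mult[of _ N] mult.commute mult.left_commute)
qed

text \<open>Singular matrices are included: since \<open>inverse 0 = 0\<close>, both sides are then
  zero. Hence conjugation commutes with the recurrence without any invertibility side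
  condition.\<close>

lemma conj_mat_minv:
  fixes Q :: "'a::field mat"
  assumes T: "T \<in> carrier_mat N N" "T' \<in> carrier_mat N N" "T' * T = 1\<^sub>m N"
    and Q: "Q \<in> carrier_mat N N"
  shows "minv (conj_mat T T' Q) = conj_mat T T' (minv Q)"
proof (cases "det Q = 0")
  case True
  then have "minv Q = 0\<^sub>m N N" "minv (conj_mat T T' Q) = 0\<^sub>m N N"
    using adj_mat(1)[OF Q] adj_mat(1)[OF conj_mat_carrier[OF T(1,2), of Q]] det_conj_mat[OF T Q]
    by (auto simp: minv_def intro!: eq_matI)
  then show ?thesis using T by (simp add: conj_mat_def)
next
  case False
  show ?thesis
  proof (rule minv_unique(2)[of _ N])
    show "conj_mat T T' Q * conj_mat T T' (minv Q) = 1\<^sub>m N"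
      using conj_mat_mult[OF T Q, of "minv Q"] False Q T mat_mult_left_right_inverse[OF T(2,1,3)]
      by (simp add: minv_mult conj_mat_def)
  qed (use T in auto)
qed

lemma conj_mat_diff:
  fixes T :: "'a::ring_1 mat"
  assumes "T \<in> carrier_mat N N" "T' \<in> carrier_mat N N" "P \<in> carrier_mat N N" "Q \<in> carrier_mat N N"
  shows "conj_mat T T' (P - Q) = conj_mat T T' P - conj_mat T T' Q"
  using assms unfolding conj_mat_def
  by (simp add: mult_minus_distrib_mat[of _ N N] minus_mult_distrib_mat[of _ N N])

lemma conj_mat_smult:
  fixes T :: "'a::comm_ring_1 mat"
  assumes "T \<in> carrier_mat N N" "T' \<in> carrier_mat N N" "P \<in> carrier_mat N N"
  shows "conj_mat T T' (a \<cdot>\<^sub>m P) = a \<cdot>\<^sub>m conj_mat T T' P"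
  using assms unfolding conj_mat_def
  by (simp add: mult_smult_distrib[of _ N N] mult_smult_assoc_mat[of _ N N])

lemma conj_mat_step:
  fixes T :: "'a::field mat"
  assumes T: "T \<in> carrier_mat N N" "T' \<in> carrier_mat N N" "T' * T = 1\<^sub>m N"
    and "P \<in> carrier_mat N N" "Q \<in> carrier_mat N N" "R \<in> carrier_mat N N"
  shows "conj_mat T T' (a \<cdot>\<^sub>m minv Q - P - Q - R)
    = a \<cdot>\<^sub>m minv (conj_mat T T' Q) - conj_mat T T' P - conj_mat T T' Q - conj_mat T T' R"
  using assms by (simp add: conj_mat_diff[OF T(1,2)] conj_mat_smult[OF T(1,2)] conj_mat_minv[OF T] minus_carrier_mat)

lemma conj_mat_const:
  assumes "t \<in> carrier_mat N N" "t' \<in> carrier_mat N N" "M \<in> carrier_mat N N"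
  shows "coeff0 (conj_mat (const_mat t) (const_mat t') M) = conj_mat t t' (coeff0 M)"
    and "mat_ps M \<Longrightarrow> mat_ps (conj_mat (const_mat t) (const_mat t') M)"
  using assms unfolding conj_mat_def
  by (simp_all add: coeff0_const_mult[of _ N N _ N] coeff0_mult_const[of _ N N _ N] mat_ps_mult(1)[of _ N N _ N])

section \<open>The shear that clears the lower left block\<close>

definition shear :: "nat \<Rightarrow> nat \<Rightarrow> complex mat \<Rightarrow> complex mat" where
  "shear N r u = four_block_mat (1\<^sub>m r) (0\<^sub>m r (N - r)) u (1\<^sub>m (N - r))"

lemma shear_carrier:
  assumes "r \<le> N"
  shows "shear N r u \<in> carrier_mat N N"
  unfolding shear_def using assms four_block_carrier_mat[of "1\<^sub>m r" r r "1\<^sub>m (N - r)" "N - r" "N - r"] by simp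

lemma blk_shear:
  assumes "u \<in> carrier_mat (N - r) r"
  shows "blkA r (shear N r u) = 1\<^sub>m r" "blkB N r (shear N r u) = 0\<^sub>m r (N - r)"
    "blkC N r (shear N r u) = u" "blkD N r (shear N r u) = 1\<^sub>m (N - r)"
  unfolding shear_def using blk_four_block[OF _ _ assms, of "1\<^sub>m r" "0\<^sub>m r (N - r)" "1\<^sub>m (N - r)"]
  by simp_all

lemma shear_inverse:
  assumes "r \<le> N" "u \<in> carrier_mat (N - r) r"
  shows "shear N r (- u) * shear N r u = 1\<^sub>m N"
proof -
  have "shear N r (- u) * shear N r u = four_block_mat (1\<^sub>m r) (0\<^sub>m r (N - r)) (0\<^sub>m (N - r) r) (1\<^sub>m (N - r))"
    unfolding shear_def using assms
    by (subst mult_four_block_mat[of _ r r _ "N - r" _ "N - r" _ _ r _ "N - r"])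
      (auto simp: left_add_zero_mat uminus_l_inv_mat intro!: arg_cong2[of _ _ _ _ "\<lambda>x y. four_block_mat _ x y _"])
  then show ?thesis using assms by simp
qed

text \<open>Left multiplication adds \<open>u\<close> times the upper block row to the lower one,
  right multiplication subtracts the second block column times \<open>u\<close> from the first. The
  new lower right block is exactly the shape of \<open>Z\<^sub>1\<close> and
  \<open>Z\<^sub>2\<close>; when the upper blocks vanish, the new lower left block is
  \<open>C - D * u\<close>.\<close>

lemma blk_conj_shear:
  assumes r: "r \<le> N" and u: "u \<in> carrier_mat (N - r) r" and M: "M \<in> carrier_mat N N"
  defines "G \<equiv> conj_mat (shear N r u) (shear N r (- u)) M"
  shows "blkD N r G = blkD N r M + u * blkB N r M"
    and "blkB N r G = blkB N r M"
    and "blkA r M = 0\<^sub>m r r \<Longrightarrow> blkB N r M = 0\<^sub>m r (N - r) \<Longrightarrow> blkC N r M = blkD N r M * u \<Longrightarrow>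
      blkA r G = 0\<^sub>m r r \<and> blkC N r G = 0\<^sub>m (N - r) r"
proof -
  define a where "a = blkA r M"
  define b where "b = blkB N r M"
  define c where "c = blkC N r M"
  define d where "d = blkD N r M"
  have k: "a \<in> carrier_mat r r" "b \<in> carrier_mat r (N - r)" "c \<in> carrier_mat (N - r) r"
    "d \<in> carrier_mat (N - r) (N - r)"
    by (simp_all add: a_def b_def c_def d_def)
  then have k': "u * a \<in> carrier_mat (N - r) r" "u * b \<in> carrier_mat (N - r) (N - r)"
    "b * u \<in> carrier_mat r r" "d * u \<in> carrier_mat (N - r) r" "(u * b + d) * u \<in> carrier_mat (N - r) r"
    using u by (auto intro!: add_carrier_mat intro: mult_carrier_mat[OF _ u])
  note k = k k'
  have u': "- u \<in> carrier_mat (N - r) r" using u by simp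
  have S: "shear N r u * M \<in> carrier_mat N N" using shear_carrier[OF r, of u] M by auto
  note bS = blk_mult[OF shear_carrier[OF r, of u] M r, unfolded blk_shear[OF u], folded a_def b_def c_def d_def]
  have SA: "blkA r (shear N r u * M) = a" and SB: "blkB N r (shear N r u * M) = b"
    and SC: "blkC N r (shear N r u * M) = u * a + c" and SD: "blkD N r (shear N r u * M) = u * b + d"
    using k by (auto simp: bS)
  have G: "G = shear N r u * M * shear N r (- u)" by (simp add: G_def conj_mat_def)
  note bG = blk_mult[OF S shear_carrier[OF r, of "- u"] r, unfolded blk_shear[OF u'] SA SB SC SD, folded G]
  show "blkB N r G = blkB N r M" unfolding bG b_def[symmetric] using k by simp
  show "blkD N r G = blkD N r M + u * blkB N r M"
    unfolding bG b_def[symmetric] d_def[symmetric] using k u by (auto simp: comm_add_mat[of d])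
  assume "blkA r M = 0\<^sub>m r r" "blkB N r M = 0\<^sub>m r (N - r)" "blkC N r M = blkD N r M * u"
  then have "a = 0\<^sub>m r r" "b = 0\<^sub>m r (N - r)" "c = d * u"
    by (auto simp: a_def b_def c_def d_def)
  then show "blkA r G = 0\<^sub>m r r \<and> blkC N r G = 0\<^sub>m (N - r) r"
    unfolding bG using k u by (auto simp: minus_add_uminus_mat[symmetric])
qed

section \<open>The iterates and their conjugated orbit\<close>

lemma beta_initial: "m \<ge> 1 \<Longrightarrow> beta \<alpha> b0 b1 m m = b1"
  by (simp add: beta_def Let_def)

lemma beta_first:
  "m \<ge> 1 \<Longrightarrow> beta \<alpha> b0 b1 m (m + 1) = of_nat m \<cdot>\<^sub>m minv b1 - b0 - b1 - const_mat \<alpha>"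
  by (simp add: beta_def Let_def numeral_2_eq_2 Suc_diff_le)

lemma beta_step:
  assumes "m \<ge> 1"
  shows "beta \<alpha> b0 b1 m (m + k + 2) = of_nat (m + k + 1) \<cdot>\<^sub>m minv (beta \<alpha> b0 b1 m (m + k + 1))
    - beta \<alpha> b0 b1 m (m + k) - beta \<alpha> b0 b1 m (m + k + 1) - const_mat \<alpha>"
proof -
  \<comment> \<open>The sequence starts at index \<open>m - 1\<close>, so the iterate with index
    \<open>m + k\<close> sits at position \<open>k + 1\<close>; \<open>m \<ge> 1\<close> keeps the
    truncated subtraction exact.\<close>
  have "m + k + 2 - (m - 1) = Suc (Suc (Suc k))" "m + k + 1 - (m - 1) = Suc (Suc k)" "m + k - (m - 1) = Suc k"
    using assms by auto
  then show ?thesis unfolding beta_def by (simp only:) (simp add: Let_def add.assoc)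
qed

lemma beta_carrier:
  assumes "\<alpha> \<in> carrier_mat N N" "b1 \<in> carrier_mat N N" "m \<ge> 1"
  shows "beta \<alpha> b0 b1 m (m + k) \<in> carrier_mat N N"
proof (cases k)
  case (Suc j)
  then show ?thesis
    using assms beta_first[OF assms(3), of \<alpha> b0 b1] beta_step[OF assms(3), of \<alpha> b0 b1 "j - 1"]
    by (cases j) (auto intro!: minus_carrier_mat)
qed (use assms beta_initial in auto)

text \<open>Entries outside the lower right block lose their constant term and so gain one order;
  the leading block consists of the coefficients of \<epsilon>.\<close>

lemma graded_1_of_ps:
  assumes g: "g \<in> carrier_mat N N" "mat_ps g" and r: "r \<le> N"
    and blk: "blkA r (coeff0 g) = 0\<^sub>m r r" "blkB N r (coeff0 g) = 0\<^sub>m r (N - r)"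
      "blkC N r (coeff0 g) = 0\<^sub>m (N - r) r"
  shows "graded 1 N r g (mat r r (\<lambda>(i,j). fls_nth (g $$ (i,j)) 1))"
  unfolding graded_def
proof (intro conjI allI impI)
  fix i j assume ij: "i < N" "j < N"
  have p: "order_ge 0 (g $$ (i,j))" using g ij by (auto simp: mat_ps_def)
  have "fls_nth (g $$ (i,j)) 0 = 0" if "i < r \<or> j < r"
  proof -
    consider "i < r" "j < r" | "i < r" "\<not> j < r" | "\<not> i < r" "j < r" using \<open>i < r \<or> j < r\<close> by blast
    then have "coeff0 g $$ (i,j) = 0"
    proof cases
      case 1
      then show ?thesis using arg_cong[OF blk(1), of "\<lambda>X. X $$ (i,j)"] by (simp add: blkA_def)
    next
      case 2
      then show ?thesis using arg_cong[OF blk(2), of "\<lambda>X. X $$ (i,j - r)"] ij by (simp add: blkB_def)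
    next
      case 3
      then show ?thesis using arg_cong[OF blk(3), of "\<lambda>X. X $$ (i - r,j)"] ij by (simp add: blkC_def)
    qed
    then show ?thesis using g ij by (simp add: coeff0_index)
  qed
  then show "order_ge (if i < r \<and> j < r then 1 else if i < r \<or> j < r then max 0 1 else 0) (g $$ (i,j))"
    using p order_ge_lead_zero[OF p] by auto
qed (use g r in auto)

text \<open>The orbit is conjugated by the constant shear \<open>t\<close>. Determinants are
  unchanged, the recurrence is preserved with \<alpha> conjugated too, and the constant lower right
  blocks become \<open>Z k\<close>, so \<open>singularity_confinement\<close> applies to the
  conjugated orbit.\<close>

lemma beta_confinement:
  assumes r: "r \<le> N" and m: "m \<ge> 1" and ad: "admissible N r \<alpha> b0 b1"
  defines "B \<equiv> \<lambda>k. beta \<alpha> b0 b1 m (m + k)"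
  defines "u \<equiv> minv (blkD N r (coeff0 b1)) * blkC N r (coeff0 b1)"
  defines "Z \<equiv> \<lambda>k. blkD N r (coeff0 (B k)) + u * blkB N r (coeff0 (B k))"
  assumes D0: "det (blkD N r (coeff0 b1)) \<noteq> 0"
  shows "exact_order (det (B 1)) (- int r) \<longleftrightarrow> det (Z 1) \<noteq> 0"
    and "det (Z 1) \<noteq> 0 \<Longrightarrow> exact_order (det (B 2)) (- int r) \<longleftrightarrow> det (Z 2) \<noteq> 0"
    and "det (Z 1) \<noteq> 0 \<Longrightarrow> det (Z 2) \<noteq> 0 \<Longrightarrow>
      exact_order (det (B 3)) (int r) \<longleftrightarrow> det (blkD N r (coeff0 (B 3))) \<noteq> 0"
    and "det (Z 1) \<noteq> 0 \<Longrightarrow> det (Z 2) \<noteq> 0 \<Longrightarrow> det (blkD N r (coeff0 (B 3))) \<noteq> 0 \<Longrightarrow>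
      order_ge 0 (det (B 4))"
proof -
  have c: "\<alpha> \<in> carrier_mat N N" "b0 \<in> carrier_mat N N" "b1 \<in> carrier_mat N N"
    and ord: "exact_order (det b1) (int r)"
    and ps: "mat_ps b0" "mat_ps b1"
    and top: "\<And>i j. i < r \<Longrightarrow> j < N \<Longrightarrow> fls_nth (b1 $$ (i,j)) 0 = 0"
    using ad by (auto simp: admissible_def mat_ps_def order_ge_def is_power_series_def)
  have Bc: "B k \<in> carrier_mat N N" for k unfolding B_def by (rule beta_carrier[OF c(1,3) m])
  have B0: "B 0 = b1" using beta_initial[OF m] by (simp add: B_def)
  have u: "u \<in> carrier_mat (N - r) r" unfolding u_def by (rule mult_carrier_mat[of _ _ "N - r"]) auto
  define t where "t = shear N r u"
  define t' where "t' = shear N r (- u)"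
  have t: "t \<in> carrier_mat N N" "t' \<in> carrier_mat N N" by (auto simp: t_def t'_def shear_carrier[OF r])
  define T where "T = const_mat t"
  define T' where "T' = const_mat t'"
  have T: "T \<in> carrier_mat N N" "T' \<in> carrier_mat N N" using t by (auto simp: T_def T'_def)
  have TT: "T' * T = 1\<^sub>m N"
    unfolding T_def T'_def
    using const_mat_mult[OF t(2,1)] shear_inverse[OF r u] by (simp add: t_def t'_def const_mat_one)
  define g where "g k = conj_mat T T' (B k)" for k
  have gc: "g k \<in> carrier_mat N N" for k unfolding g_def using T by simp
  have c0: "coeff0 (g k) = conj_mat t t' (coeff0 (B k))" for k
    unfolding g_def T_def T'_def by (rule conj_mat_const(1)[OF t Bc])
  note blk = blk_conj_shear[OF r u, folded t_def t'_def]
  have D: "blkD N r (coeff0 (g k)) = Z k" "blkB N r (coeff0 (g k)) = blkB N r (coeff0 (B k))" for k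
    unfolding c0 Z_def using blk(1,2)[of "coeff0 (B k)"] Bc by auto
  have "coeff0 b1 \<in> carrier_mat N N" using c by simp
  moreover have "blkA r (coeff0 b1) = 0\<^sub>m r r" "blkB N r (coeff0 b1) = 0\<^sub>m r (N - r)"
    using top c r by (auto intro!: eq_matI simp: blkA_def blkB_def coeff0_index)
  \<comment> \<open>This equation is the reason for choosing \<open>u\<close> as the inverse of the
    lower right block times the lower left one.\<close>
  moreover have "blkC N r (coeff0 b1) = blkD N r (coeff0 b1) * u"
    unfolding u_def using minv_mult(1)[OF _ D0, of "N - r"]
    by (subst assoc_mult_mat[symmetric, of _ "N - r" "N - r" _ "N - r" _ r])
      (auto simp: left_mult_one_mat[of _ "N - r" r])
  ultimately have b: "blkA r (coeff0 (g 0)) = 0\<^sub>m r r" "blkB N r (coeff0 (g 0)) = 0\<^sub>m r (N - r)"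
    "blkC N r (coeff0 (g 0)) = 0\<^sub>m (N - r) r"
    using blk(2,3)[of "coeff0 b1"] unfolding c0 B0 by simp_all
  have "mat_ps (g 0)"
    unfolding g_def B0 T_def T'_def by (rule conj_mat_const(2)[OF t c(3) ps(2)])
  note G0 = graded_1_of_ps[OF gc this r b]
  have dg: "det (g k) = det (B k)" for k unfolding g_def by (rule det_conj_mat[OF T TT Bc])
  have ord0: "exact_order (det (g 0)) (int r)" using ord by (simp add: dg B0)
  define p where "p = conj_mat T T' b0"
  define al where "al = conj_mat T T' (const_mat \<alpha>)"
  have p: "p \<in> carrier_mat N N" "mat_ps p"
    unfolding p_def using conj_mat_const(2)[OF t c(2) ps(1)] T by (auto simp: T_def T'_def)
  have al: "al \<in> carrier_mat N N" "mat_ps al"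
    unfolding al_def using conj_mat_const(2)[OF t, of "const_mat \<alpha>"] T c by (auto simp: T_def T'_def)
  have ac: "const_mat \<alpha> \<in> carrier_mat N N" using c by simp
  have g1: "g 1 = of_nat m \<cdot>\<^sub>m minv (g 0) - p - g 0 - al"
    unfolding g_def p_def al_def B0 using beta_first[OF m, of \<alpha> b0 b1] conj_mat_step[OF T TT c(2,3) ac]
    by (simp add: B_def)
  have gs: "g (k + 2) = of_nat (m + k + 1) \<cdot>\<^sub>m minv (g (k + 1)) - g k - g (k + 1) - al" for k
    unfolding g_def al_def conj_mat_step[OF T TT Bc Bc ac, symmetric]
    using beta_step[OF m, of \<alpha> b0 b1 k] by (simp add: B_def add.assoc)
  have g2: "g 2 = of_nat (m + 1) \<cdot>\<^sub>m minv (g 1) - g 0 - g 1 - al"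
    using gs[of 0] by (simp add: numeral_2_eq_2)
  have g3: "g 3 = of_nat (m + 2) \<cdot>\<^sub>m minv (g 2) - g 1 - g 2 - al"
    using gs[of 1] by (simp add: numeral_eq_Suc)
  have g4: "g 4 = of_nat (m + 3) \<cdot>\<^sub>m minv (g 3) - g 2 - g 3 - al"
    using gs[of 2] by (simp add: numeral_eq_Suc)
  have "0 < m" using m by simp
  note main = singularity_confinement[OF this G0 ord0 p al g1 g2 g3 g4, unfolded D(1) dg]
  show "exact_order (det (B 1)) (- int r) \<longleftrightarrow> det (Z 1) \<noteq> 0"
    and "det (Z 1) \<noteq> 0 \<Longrightarrow> exact_order (det (B 2)) (- int r) \<longleftrightarrow> det (Z 2) \<noteq> 0"
    by (fact main(1), fact main(2))
  \<comment> \<open>The upper right constant block vanishes at this iterate, so the shear correction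
    drops out; hence \<open>Z\<^sub>3\<close> is a plain block, unlike \<open>Z\<^sub>1\<close> and
    \<open>Z\<^sub>2\<close>.\<close>
  have Z3: "Z 3 = blkD N r (coeff0 (B 3))" if "det (Z 1) \<noteq> 0" "det (Z 2) \<noteq> 0"
  proof -
    have "blkB N r (coeff0 (B 3)) = 0\<^sub>m r (N - r)" using main(4)[OF that] D(2)[of 3] by simp
    then show ?thesis unfolding Z_def using right_mult_zero_mat[OF u] right_add_zero_mat[OF blk_carrier(4)] by simp
  qed
  show "exact_order (det (B 3)) (int r) \<longleftrightarrow> det (blkD N r (coeff0 (B 3))) \<noteq> 0"
    if "det (Z 1) \<noteq> 0" "det (Z 2) \<noteq> 0"
    using main(3)[OF that] Z3[OF that] by simp
  show "order_ge 0 (det (B 4))"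
    if "det (Z 1) \<noteq> 0" "det (Z 2) \<noteq> 0" "det (blkD N r (coeff0 (B 3))) \<noteq> 0"
    using main(5) that Z3[OF that(1,2)] mat_ps_det(1)[of "g 4" N] by (simp add: dg)
qed

section \<open>Rational dependence on the parameters\<close>

text \<open>Different indices may share an exponent vector, and their coefficients may cancel.
  Collecting equal exponents gives the normal form demanded by \<open>polyfun\<close>, so closure
  proofs can list monomials freely.\<close>

lemma polyfunI:
  fixes a :: "'i \<Rightarrow> complex" and e :: "'i \<Rightarrow> coord \<Rightarrow> nat"
  assumes I: "finite I" and V: "finite V" and supp: "\<And>i v. i \<in> I \<Longrightarrow> v \<notin> V \<Longrightarrow> e i v = 0"
    and P: "\<And>x. P x = (\<Sum>i\<in>I. a i * (\<Prod>v\<in>V. x v ^ e i v))"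
  shows "polyfun P"
proof -
  define c where "c = (\<lambda>f. \<Sum>i\<in>{i \<in> I. e i = f}. a i)"
  have sub: "{f. c f \<noteq> 0} \<subseteq> e ` I"
  proof
    fix f assume "f \<in> {f. c f \<noteq> 0}"
    then have "{i \<in> I. e i = f} \<noteq> {}" unfolding c_def by force
    then show "f \<in> e ` I" by auto
  qed
  have fin: "finite {f. c f \<noteq> 0}" using sub I by (meson finite_imageI finite_subset)
  have "P x = (\<Sum>f\<in>{f. c f \<noteq> 0}. c f * (\<Prod>v\<in>V. x v ^ f v))" for x
  proof -
    have "P x = (\<Sum>f\<in>e ` I. \<Sum>i\<in>{i \<in> I. e i = f}. a i * (\<Prod>v\<in>V. x v ^ e i v))"
      unfolding P by (rule sum.image_gen[OF I])
    also have "\<dots> = (\<Sum>f\<in>e ` I. c f * (\<Prod>v\<in>V. x v ^ f v))"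
      unfolding c_def sum_distrib_right by (intro sum.cong) auto
    also have "\<dots> = (\<Sum>f\<in>{f. c f \<noteq> 0}. c f * (\<Prod>v\<in>V. x v ^ f v))"
      using sub I by (intro sum.mono_neutral_right) auto
    finally show ?thesis .
  qed
  moreover have "\<forall>f. c f \<noteq> 0 \<longrightarrow> (\<forall>v. v \<notin> V \<longrightarrow> f v = 0)"
  proof (intro allI impI)
    fix f v assume "c f \<noteq> 0" "v \<notin> V"
    then obtain i where "i \<in> I" "f = e i" using sub by auto
    then show "f v = 0" using supp \<open>v \<notin> V\<close> by simp
  qed
  ultimately show ?thesis
    unfolding polyfun_def using fin V by (intro exI[of _ c] exI[of _ V]) simp
qed

text \<open>Variables outside \<open>V\<close> enter with exponent 0, so the product may range over
  any larger finite \<open>W\<close>. Two polynomials can thus be written over a common set of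
  variables.\<close>

lemma polyfunE:
  assumes "polyfun P"
  obtains a and E :: "(coord \<Rightarrow> nat) set" and V where "finite E" "finite V" "\<And>f v. f \<in> E \<Longrightarrow> v \<notin> V \<Longrightarrow> f v = 0"
    "\<And>W x. finite W \<Longrightarrow> V \<subseteq> W \<Longrightarrow> P x = (\<Sum>f\<in>E. a f * (\<Prod>v\<in>W. x v ^ f v))"
proof -
  obtain c V where V: "finite V" "finite {f. c f \<noteq> 0}" "\<forall>f. c f \<noteq> 0 \<longrightarrow> (\<forall>v. v \<notin> V \<longrightarrow> f v = 0)"
    and P: "\<forall>x. P x = (\<Sum>f\<in>{f. c f \<noteq> 0}. c f * (\<Prod>v\<in>V. x v ^ f v))"
    using assms unfolding polyfun_def by blast
  have "P x = (\<Sum>f\<in>{f. c f \<noteq> 0}. c f * (\<Prod>v\<in>W. x v ^ f v))" if W: "finite W" "V \<subseteq> W" for W x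
  proof -
    have "(\<Prod>v\<in>V. x v ^ f v) = (\<Prod>v\<in>W. x v ^ f v)" if "c f \<noteq> 0" for f
      using V(3) that W by (intro prod.mono_neutral_left) auto
    then show ?thesis using P by simp
  qed
  with V show ?thesis by (intro that[of "{f. c f \<noteq> 0}" V c]) blast+
qed

lemma polyfun_const [simp]: "polyfun (\<lambda>x. c)"
  by (rule polyfunI[of "{()}" "{}" "\<lambda>_ _. 0" _ "\<lambda>_. c"]) auto

lemma polyfun_var: "polyfun (\<lambda>x. x v)"
  by (rule polyfunI[of "{()}" "{v}" "\<lambda>_ w. if w = v then 1 else 0" _ "\<lambda>_. 1"]) auto

lemma polyfun_add:
  assumes "polyfun P" "polyfun Q"
  shows "polyfun (\<lambda>x. P x + Q x)"
proof -
  obtain a E V where 1: "finite E" "finite V" "\<And>f v. f \<in> E \<Longrightarrow> v \<notin> V \<Longrightarrow> f v = 0"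
    "\<And>W x. finite W \<Longrightarrow> V \<subseteq> W \<Longrightarrow> P x = (\<Sum>f\<in>E. a f * (\<Prod>v\<in>W. x v ^ f v))"
    by (rule polyfunE[OF assms(1)], rule that)
  obtain b F U where 2: "finite F" "finite U" "\<And>f v. f \<in> F \<Longrightarrow> v \<notin> U \<Longrightarrow> f v = 0"
    "\<And>W x. finite W \<Longrightarrow> U \<subseteq> W \<Longrightarrow> Q x = (\<Sum>f\<in>F. b f * (\<Prod>v\<in>W. x v ^ f v))"
    by (rule polyfunE[OF assms(2)], rule that)
  show ?thesis
  \<comment> \<open>The disjoint union keeps monomials common to both polynomials apart;
    \<open>polyfunI\<close> merges them.\<close>
  proof (rule polyfunI[of "E <+> F" "V \<union> U" "case_sum id id" _ "case_sum a b"])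
    fix x show "P x + Q x = (\<Sum>i\<in>E <+> F. case_sum a b i * (\<Prod>v\<in>V \<union> U. x v ^ case_sum id id i v))"
      using 1(4)[of "V \<union> U" x] 2(4)[of "V \<union> U" x] 1(1,2) 2(1,2) by (simp add: sum.Plus)
  qed (use 1(1-3) 2(1-3) in auto)
qed

lemma polyfun_mult:
  assumes "polyfun P" "polyfun Q"
  shows "polyfun (\<lambda>x. P x * Q x)"
proof -
  obtain a E V where 1: "finite E" "finite V" "\<And>f v. f \<in> E \<Longrightarrow> v \<notin> V \<Longrightarrow> f v = 0"
    "\<And>W x. finite W \<Longrightarrow> V \<subseteq> W \<Longrightarrow> P x = (\<Sum>f\<in>E. a f * (\<Prod>v\<in>W. x v ^ f v))"
    by (rule polyfunE[OF assms(1)], rule that)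
  obtain b F U where 2: "finite F" "finite U" "\<And>f v. f \<in> F \<Longrightarrow> v \<notin> U \<Longrightarrow> f v = 0"
    "\<And>W x. finite W \<Longrightarrow> U \<subseteq> W \<Longrightarrow> Q x = (\<Sum>f\<in>F. b f * (\<Prod>v\<in>W. x v ^ f v))"
    by (rule polyfunE[OF assms(2)], rule that)
  show ?thesis
  \<comment> \<open>Pairs of monomials index the product; different pairs may give the same exponent
    sum.\<close>
  proof (rule polyfunI[of "E \<times> F" "V \<union> U" "\<lambda>(f,g) v. f v + g v" _ "\<lambda>(f,g). a f * b g"])
    fix x show "P x * Q x = (\<Sum>i\<in>E \<times> F. (case i of (f,g) \<Rightarrow> a f * b g) *
        (\<Prod>v\<in>V \<union> U. x v ^ (case i of (f,g) \<Rightarrow> \<lambda>v. f v + g v) v))"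
      using 1(4)[of "V \<union> U" x] 2(4)[of "V \<union> U" x] 1(1,2) 2(1,2)
      by (auto simp: sum_product sum.cartesian_product power_add prod.distrib mult_ac intro!: sum.cong)
  qed (use 1(1-3) 2(1-3) in auto)
qed

section \<open>Rational functions on a parameter set\<close>

text \<open>One pair of polynomials in the coordinates \<pi> serves the whole of \<open>S\<close>,
  and the denominator vanishes nowhere on \<open>S\<close>. Consequently \<open>f\<close> and its
  numerator \<open>P\<close> have the same zeros there.\<close>

definition rational_on :: "'p set \<Rightarrow> ('p \<Rightarrow> coord \<Rightarrow> complex) \<Rightarrow> ('p \<Rightarrow> complex) \<Rightarrow> bool" where
  "rational_on S \<pi> f \<longleftrightarrow> (\<exists>P Q. polyfun P \<and> polyfun Q \<and> (\<forall>s\<in>S. Q (\<pi> s) \<noteq> 0 \<and> f s * Q (\<pi> s) = P (\<pi> s)))"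

lemma rational_on_cong: "rational_on S \<pi> f \<Longrightarrow> (\<And>s. s \<in> S \<Longrightarrow> f s = g s) \<Longrightarrow> rational_on S \<pi> g"
  unfolding rational_on_def by metis

lemma rational_on_polyfun: "polyfun P \<Longrightarrow> rational_on S \<pi> (\<lambda>s. P (\<pi> s))"
  unfolding rational_on_def by (intro exI[of _ P] exI[of _ "\<lambda>_. 1"]) simp

lemma rational_on_const [simp]: "rational_on S \<pi> (\<lambda>s. c)"
  using rational_on_polyfun[OF polyfun_const] .

lemma rational_on_add:
  assumes "rational_on S \<pi> f" "rational_on S \<pi> g"
  shows "rational_on S \<pi> (\<lambda>s. f s + g s)"
proof -
  obtain P Q P' Q' where h: "polyfun P" "polyfun Q" "\<forall>s\<in>S. Q (\<pi> s) \<noteq> 0 \<and> f s * Q (\<pi> s) = P (\<pi> s)"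
    "polyfun P'" "polyfun Q'" "\<forall>s\<in>S. Q' (\<pi> s) \<noteq> 0 \<and> g s * Q' (\<pi> s) = P' (\<pi> s)"
    using assms unfolding rational_on_def by blast
  show ?thesis unfolding rational_on_def
  proof (intro exI conjI ballI)
    show "polyfun (\<lambda>x. P x * Q' x + P' x * Q x)" "polyfun (\<lambda>x. Q x * Q' x)"
      using h by (auto intro: polyfun_add polyfun_mult)
    fix s assume "s \<in> S"
    moreover have e: "P (\<pi> s) = f s * Q (\<pi> s)" "P' (\<pi> s) = g s * Q' (\<pi> s)"
      and nz: "Q (\<pi> s) \<noteq> 0" "Q' (\<pi> s) \<noteq> 0"
      using h(3,6) calculation by simp_all
    ultimately show "Q (\<pi> s) * Q' (\<pi> s) \<noteq> 0"
      "(f s + g s) * (Q (\<pi> s) * Q' (\<pi> s)) = P (\<pi> s) * Q' (\<pi> s) + P' (\<pi> s) * Q (\<pi> s)"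
      unfolding e using nz by (simp_all add: algebra_simps)
  qed
qed

lemma rational_on_mult:
  assumes "rational_on S \<pi> f" "rational_on S \<pi> g"
  shows "rational_on S \<pi> (\<lambda>s. f s * g s)"
proof -
  obtain P Q P' Q' where h: "polyfun P" "polyfun Q" "\<forall>s\<in>S. Q (\<pi> s) \<noteq> 0 \<and> f s * Q (\<pi> s) = P (\<pi> s)"
    "polyfun P'" "polyfun Q'" "\<forall>s\<in>S. Q' (\<pi> s) \<noteq> 0 \<and> g s * Q' (\<pi> s) = P' (\<pi> s)"
    using assms unfolding rational_on_def by blast
  show ?thesis unfolding rational_on_def
  proof (intro exI conjI ballI)
    show "polyfun (\<lambda>x. P x * P' x)" "polyfun (\<lambda>x. Q x * Q' x)"
      using h by (auto intro: polyfun_mult)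
    fix s assume "s \<in> S"
    moreover have e: "P (\<pi> s) = f s * Q (\<pi> s)" "P' (\<pi> s) = g s * Q' (\<pi> s)"
      and nz: "Q (\<pi> s) \<noteq> 0" "Q' (\<pi> s) \<noteq> 0"
      using h(3,6) calculation by simp_all
    ultimately show "Q (\<pi> s) * Q' (\<pi> s) \<noteq> 0"
      "(f s * g s) * (Q (\<pi> s) * Q' (\<pi> s)) = P (\<pi> s) * P' (\<pi> s)"
      unfolding e using nz by (simp_all add: algebra_simps)
  qed
qed

text \<open>Numerator and denominator change places; nonvanishing of \<open>f\<close> on
  \<open>S\<close> makes the new denominator admissible.\<close>

lemma rational_on_inverse:
  assumes "rational_on S \<pi> f" "\<And>s. s \<in> S \<Longrightarrow> f s \<noteq> 0"
  shows "rational_on S \<pi> (\<lambda>s. inverse (f s))"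
proof -
  obtain P Q where h: "polyfun P" "polyfun Q" "\<forall>s\<in>S. Q (\<pi> s) \<noteq> 0 \<and> f s * Q (\<pi> s) = P (\<pi> s)"
    using assms(1) unfolding rational_on_def by blast
  show ?thesis unfolding rational_on_def
  proof (intro exI conjI ballI)
    show "polyfun Q" "polyfun P" by fact+
    fix s assume s: "s \<in> S"
    show "P (\<pi> s) \<noteq> 0" "inverse (f s) * P (\<pi> s) = Q (\<pi> s)"
      using h(3)[rule_format, OF s] assms(2)[OF s] by (auto simp: field_simps)
  qed
qed

lemma rational_on_diff:
  assumes "rational_on S \<pi> f" "rational_on S \<pi> g"
  shows "rational_on S \<pi> (\<lambda>s. f s - g s)"
  using rational_on_add[OF assms(1) rational_on_mult[OF rational_on_const[of S \<pi> "-1"] assms(2)]] by simp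

lemma rational_on_sum:
  "(\<And>i. i \<in> I \<Longrightarrow> rational_on S \<pi> (\<lambda>s. f s i)) \<Longrightarrow> rational_on S \<pi> (\<lambda>s. \<Sum>i\<in>I. f s i)"
  by (induction I rule: infinite_finite_induct) (auto intro: rational_on_add)

section \<open>Laurent series with rational coefficients\<close>

text \<open>The order bound \<open>h\<close> is uniform over \<open>S\<close>. Without it the number
  of terms in a coefficient of a product could vary with the point, and no single rational
  expression would result.\<close>

definition rational_series :: "'p set \<Rightarrow> ('p \<Rightarrow> coord \<Rightarrow> complex) \<Rightarrow> ('p \<Rightarrow> complex fls) \<Rightarrow> bool" where
  "rational_series S \<pi> f \<longleftrightarrow> (\<exists>h. \<forall>s\<in>S. order_ge h (f s)) \<and> (\<forall>k. rational_on S \<pi> (\<lambda>s. fls_nth (f s) k))"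

lemma rational_seriesI:
  "(\<And>s. s \<in> S \<Longrightarrow> order_ge h (f s)) \<Longrightarrow> (\<And>k. rational_on S \<pi> (\<lambda>s. fls_nth (f s) k)) \<Longrightarrow>
    rational_series S \<pi> f"
  unfolding rational_series_def by blast

lemma rational_seriesD: "rational_series S \<pi> f \<Longrightarrow> rational_on S \<pi> (\<lambda>s. fls_nth (f s) k)"
  unfolding rational_series_def by simp

lemma rational_series_order:
  assumes "rational_series S \<pi> f"
  obtains h where "\<And>s. s \<in> S \<Longrightarrow> order_ge h (f s)"
  using assms unfolding rational_series_def by blast

lemma rational_series_cong:
  assumes f: "rational_series S \<pi> f" and fg: "\<And>s. s \<in> S \<Longrightarrow> f s = g s"
  shows "rational_series S \<pi> g"
proof -
  obtain h where "\<And>s. s \<in> S \<Longrightarrow> order_ge h (f s)" by (rule rational_series_order[OF f], rule that)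
  then show ?thesis
    using fg by (intro rational_seriesI[of S h] rational_on_cong[OF rational_seriesD[OF f]]) simp_all
qed

lemma rational_series_const [simp]: "rational_series S \<pi> (\<lambda>s. c)"
  by (rule rational_seriesI[of S "fls_subdegree c"]) (simp_all add: order_ge_def)

lemma rational_series_add:
  assumes "rational_series S \<pi> f" "rational_series S \<pi> g"
  shows "rational_series S \<pi> (\<lambda>s. f s + g s)"
proof -
  obtain h where h: "\<And>s. s \<in> S \<Longrightarrow> order_ge h (f s)" by (rule rational_series_order[OF assms(1)], rule that)
  obtain h' where h': "\<And>s. s \<in> S \<Longrightarrow> order_ge h' (g s)" by (rule rational_series_order[OF assms(2)], rule that)
  have "order_ge (min h h') (f s + g s)" if "s \<in> S" for s
    by (rule order_ge_add[OF order_ge_mono[OF h[OF that]] order_ge_mono[OF h'[OF that]]]) auto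
  then show ?thesis
    by (rule rational_seriesI) (simp_all add: rational_on_add rational_seriesD[OF assms(1)] rational_seriesD[OF assms(2)])
qed

lemma rational_series_mult:
  assumes "rational_series S \<pi> f" "rational_series S \<pi> g"
  shows "rational_series S \<pi> (\<lambda>s. f s * g s)"
proof -
  obtain h where h: "\<And>s. s \<in> S \<Longrightarrow> order_ge h (f s)" by (rule rational_series_order[OF assms(1)], rule that)
  obtain h' where h': "\<And>s. s \<in> S \<Longrightarrow> order_ge h' (g s)" by (rule rational_series_order[OF assms(2)], rule that)
  have "rational_on S \<pi> (\<lambda>s. \<Sum>i=h..k-h'. fls_nth (f s) i * fls_nth (g s) (k - i))" for k
    by (intro rational_on_sum rational_on_mult rational_seriesD assms)
  then have "rational_on S \<pi> (\<lambda>s. fls_nth (f s * g s) k)" for k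
    by (rule rational_on_cong)
      (rule fls_nth_mult_bounded[symmetric]; use h h' in \<open>simp add: order_ge_def\<close>)
  then show ?thesis
    using order_ge_mult[OF h h'] by (intro rational_seriesI[of S "h + h'"])
qed

lemma rational_series_diff:
  assumes "rational_series S \<pi> f" "rational_series S \<pi> g"
  shows "rational_series S \<pi> (\<lambda>s. f s - g s)"
  using rational_series_add[OF assms(1) rational_series_mult[OF rational_series_const[of S \<pi> "-1"] assms(2)]] by simp

lemma rational_series_sum:
  "(\<And>i. i \<in> I \<Longrightarrow> rational_series S \<pi> (\<lambda>s. f s i)) \<Longrightarrow> rational_series S \<pi> (\<lambda>s. \<Sum>i\<in>I. f s i)"
  by (induction I rule: infinite_finite_induct) (auto intro: rational_series_add)

lemma rational_series_prod:
  "(\<And>i. i \<in> I \<Longrightarrow> rational_series S \<pi> (\<lambda>s. f s i)) \<Longrightarrow> rational_series S \<pi> (\<lambda>s. \<Prod>i\<in>I. f s i)"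
  by (induction I rule: infinite_finite_induct) (auto intro: rational_series_mult)

text \<open>Comparing coefficients in \<open>f * inverse f = 1\<close> gives a recursion for the
  coefficients of the inverse. Each step divides only by the coefficient of order \<open>k\<close>,
  which is nonzero on all of \<open>S\<close> because the exact order is the same
  everywhere.\<close>

lemma rational_series_inverse:
  assumes f: "rational_series S \<pi> f" and k: "\<And>s. s \<in> S \<Longrightarrow> exact_order (f s) k"
  shows "rational_series S \<pi> (\<lambda>s. inverse (f s))"
proof -
  let ?h = "\<lambda>s. inverse (f s)"
  have o: "order_ge k (f s)" "order_ge (- k) (?h s)" "fls_nth (f s) k \<noteq> 0" "f s \<noteq> 0" if "s \<in> S" for s
    using k[OF that] order_ge_inverse[OF k[OF that]] by (auto simp: exact_order_iff)
  have f_rat: "rational_on S \<pi> (\<lambda>s. fls_nth (f s) i)" for i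
    using f by (simp add: rational_series_def)
  \<comment> \<open>Coefficients are counted from the lowest possible order \<open>- k\<close>
    upwards, which makes strong induction on naturals available.\<close>
  have rat: "rational_on S \<pi> (\<lambda>s. fls_nth (?h s) (int n - k))" for n
  proof (induction n rule: less_induct)
    case (less n)
    let ?g = "\<lambda>s. ((if n = 0 then 1 else 0) - (\<Sum>i=k+1..int n + k. fls_nth (f s) i * fls_nth (?h s) (int n - i)))
      * inverse (fls_nth (f s) k)"
    have "rational_on S \<pi> (\<lambda>s. fls_nth (?h s) (int n - i))" if "i \<in> {k+1..int n + k}" for i
    proof -
      have "nat (int n - i + k) < n" "int n - i = int (nat (int n - i + k)) - k" using that by auto
      then show ?thesis using less[of "nat (int n - i + k)"] by simp
    qed
    then have "rational_on S \<pi> ?g"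
      using f_rat o(3) by (intro rational_on_mult rational_on_diff rational_on_sum rational_on_inverse) auto
    moreover have "?g s = fls_nth (?h s) (int n - k)" if s: "s \<in> S" for s
    proof -
      \<comment> \<open>The coefficient of order \<open>n\<close> in the product is that of 1; the
        term \<open>i = k\<close> is the only one containing the new unknown.\<close>
      have "(if n = 0 then 1 else 0) = fls_nth (f s * ?h s) (int n)" using o(4)[OF s] by simp
      also have "\<dots> = (\<Sum>i=k..int n + k. fls_nth (f s) i * fls_nth (?h s) (int n - i))"
        using o(1,2)[OF s] by (subst fls_nth_mult_bounded[of k _ "- k"]) (auto simp: order_ge_def)
      also have "{k..int n + k} = insert k {k+1..int n + k}" by auto
      also have "(\<Sum>i\<in>insert k {k+1..int n + k}. fls_nth (f s) i * fls_nth (?h s) (int n - i))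
        = fls_nth (f s) k * fls_nth (?h s) (int n - k) + (\<Sum>i=k+1..int n + k. fls_nth (f s) i * fls_nth (?h s) (int n - i))"
        by (subst sum.insert) auto
      finally have "(if n = 0 then 1 else 0) - (\<Sum>i=k+1..int n + k. fls_nth (f s) i * fls_nth (?h s) (int n - i))
        = fls_nth (f s) k * fls_nth (?h s) (int n - k)" by (simp add: algebra_simps)
      then show ?thesis using o(3)[OF s] by simp
    qed
    ultimately show ?case by (rule rational_on_cong)
  qed
  have "rational_on S \<pi> (\<lambda>s. fls_nth (?h s) j)" for j
  proof (cases "j < - k")
    case True
    then show ?thesis
      using o(2) by (intro rational_on_cong[OF rational_on_const[of S \<pi> 0]]) (auto simp: order_ge_def)
  next
    case False
    then show ?thesis using rat[of "nat (j + k)"] by simp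
  qed
  then show ?thesis using o(2) by (intro rational_seriesI[of S "- k"])
qed

section \<open>Matrices with rational coefficients\<close>

definition rational_mat :: "'p set \<Rightarrow> ('p \<Rightarrow> coord \<Rightarrow> complex) \<Rightarrow> nat \<Rightarrow> ('p \<Rightarrow> complex fls mat) \<Rightarrow> bool" where
  "rational_mat S \<pi> n M \<longleftrightarrow> (\<forall>s\<in>S. M s \<in> carrier_mat n n) \<and>
     (\<forall>i<n. \<forall>j<n. rational_series S \<pi> (\<lambda>s. M s $$ (i,j)))"

lemma rational_matI:
  "(\<And>s. s \<in> S \<Longrightarrow> M s \<in> carrier_mat n n) \<Longrightarrow>
    (\<And>i j. i < n \<Longrightarrow> j < n \<Longrightarrow> rational_series S \<pi> (\<lambda>s. M s $$ (i,j))) \<Longrightarrow> rational_mat S \<pi> n M"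
  unfolding rational_mat_def by simp

lemma rational_matD:
  assumes "rational_mat S \<pi> n M"
  shows "s \<in> S \<Longrightarrow> M s \<in> carrier_mat n n"
    and "i < n \<Longrightarrow> j < n \<Longrightarrow> rational_series S \<pi> (\<lambda>s. M s $$ (i,j))"
  using assms unfolding rational_mat_def by simp_all

lemma rational_mat_diff:
  assumes A: "rational_mat S \<pi> n A" and B: "rational_mat S \<pi> n B"
  shows "rational_mat S \<pi> n (\<lambda>s. A s - B s)"
proof (rule rational_matI)
  fix i j assume ij: "i < n" "j < n"
  have "A s $$ (i,j) - B s $$ (i,j) = (A s - B s) $$ (i,j)" if "s \<in> S" for s
    using rational_matD(1)[OF A that] rational_matD(1)[OF B that] ij by simp
  then show "rational_series S \<pi> (\<lambda>s. (A s - B s) $$ (i,j))"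
    by (rule rational_series_cong[OF rational_series_diff[OF rational_matD(2)[OF A ij] rational_matD(2)[OF B ij]]])
qed (rule minus_carrier_mat[OF rational_matD(1)[OF B]])

lemma rational_mat_smult:
  assumes a: "rational_series S \<pi> a" and A: "rational_mat S \<pi> n A"
  shows "rational_mat S \<pi> n (\<lambda>s. a s \<cdot>\<^sub>m A s)"
proof (rule rational_matI)
  fix i j assume ij: "i < n" "j < n"
  have "a s * A s $$ (i,j) = (a s \<cdot>\<^sub>m A s) $$ (i,j)" if "s \<in> S" for s
    using rational_matD(1)[OF A that] ij by simp
  then show "rational_series S \<pi> (\<lambda>s. (a s \<cdot>\<^sub>m A s) $$ (i,j))"
    by (rule rational_series_cong[OF rational_series_mult[OF a rational_matD(2)[OF A ij]]])
qed (simp add: rational_matD(1)[OF A])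

lemma rational_mat_det:
  assumes A: "rational_mat S \<pi> n A"
  shows "rational_series S \<pi> (\<lambda>s. det (A s))"
proof (rule rational_series_cong)
  show "rational_series S \<pi> (\<lambda>s. \<Sum>p\<in>{p. p permutes {0..<n}}. signof p * (\<Prod>i=0..<n. A s $$ (i, p i)))"
  proof (intro rational_series_sum rational_series_mult rational_series_const rational_series_prod)
    fix p i assume p: "p \<in> {p. p permutes {0..<n}}" and i: "i \<in> {0..<n}"
    then have "p i < n" using permutes_in_image[of p "{0..<n}" i] by auto
    then show "rational_series S \<pi> (\<lambda>s. A s $$ (i, p i))" using i rational_matD(2)[OF A] by simp
  qed
qed (rule det_def'[OF rational_matD(1)[OF A], symmetric])

text \<open>Cofactors are determinants of minors, so only the division by \<open>det\<close> needs
  the uniform exact order \<open>k\<close>.\<close>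

lemma rational_mat_minv:
  assumes A: "rational_mat S \<pi> n A" and k: "\<And>s. s \<in> S \<Longrightarrow> exact_order (det (A s)) k"
  shows "rational_mat S \<pi> n (\<lambda>s. minv (A s))"
  unfolding minv_def
proof (rule rational_mat_smult[OF rational_series_inverse[OF rational_mat_det[OF A] k]])
  note c = rational_matD(1)[OF A]
  have cof: "rational_series S \<pi> (\<lambda>s. cofactor (A s) j i)" if ij: "i < n" "j < n" for i j
  proof -
    have "rational_mat S \<pi> (n - 1) (\<lambda>s. mat_delete (A s) j i)"
    proof (rule rational_matI)
      fix a b assume ab: "a < n - 1" "b < n - 1"
      let ?a = "if a < j then a else Suc a" and ?b = "if b < i then b else Suc b"
      have "rational_series S \<pi> (\<lambda>s. A s $$ (?a, ?b))"
        by (rule rational_matD(2)[OF A]) (use ab in auto)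
      moreover have "A s $$ (?a, ?b) = mat_delete (A s) j i $$ (a,b)" if "s \<in> S" for s
        using c[OF that] ab by (simp add: mat_delete_def)
      ultimately show "rational_series S \<pi> (\<lambda>s. mat_delete (A s) j i $$ (a,b))"
        by (rule rational_series_cong)
    qed (rule mat_delete_carrier[OF c])
    from rational_mat_det[OF this] show ?thesis
      unfolding cofactor_def by (intro rational_series_mult rational_series_const)
  qed
  show "rational_mat S \<pi> n (\<lambda>s. adj_mat (A s))"
  proof (rule rational_matI)
    fix i j assume ij: "i < n" "j < n"
    have "cofactor (A s) j i = adj_mat (A s) $$ (i,j)" if "s \<in> S" for s
      using c[OF that] ij by (simp add: adj_mat_def)
    then show "rational_series S \<pi> (\<lambda>s. adj_mat (A s) $$ (i,j))"
      by (rule rational_series_cong[OF cof[OF ij]])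
  qed (rule adj_mat(1)[OF c])
qed

section \<open>A nondegenerate orbit of block scalar matrices\<close>

text \<open>On these block scalar matrices the recurrence splits into two independent scalar
  recurrences, a singular one for \<open>x\<close> and a regular one for \<open>y\<close>.\<close>

definition two_diag :: "nat \<Rightarrow> nat \<Rightarrow> 'a::zero \<Rightarrow> 'a \<Rightarrow> 'a mat" where
  "two_diag N r x y = mat_diag N (\<lambda>i. if i < r then x else y)"

lemma two_diag_carrier [simp]: "two_diag N r x y \<in> carrier_mat N N"
  by (simp add: two_diag_def)

lemma two_diag_index: "i < N \<Longrightarrow> j < N \<Longrightarrow> two_diag N r x y $$ (i,j) = (if i = j then if i < r then x else y else 0)"
  by (simp add: two_diag_def mat_diag_def)

lemma two_diag_dim [simp]: "dim_row (two_diag N r x y) = N" "dim_col (two_diag N r x y) = N"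
  by (simp_all add: two_diag_def mat_diag_def)

lemma two_diag_diff: "two_diag N r x y - two_diag N r x' y' = two_diag N r (x - x') (y - y')"
  for x :: "'a::ring_1"
  by (rule eq_matI) (auto simp: two_diag_index)

lemma two_diag_smult: "c \<cdot>\<^sub>m two_diag N r x y = two_diag N r (c * x) (c * y)" for x :: "'a::ring_1"
  by (rule eq_matI) (auto simp: two_diag_index)

lemma two_diag_minv:
  fixes x y :: "'a::field"
  assumes "x \<noteq> 0" "y \<noteq> 0"
  shows "minv (two_diag N r x y) = two_diag N r (inverse x) (inverse y)"
proof (rule minv_unique(2)[of _ N])
  have "two_diag N r x y * two_diag N r (inverse x) (inverse y) = mat_diag N (\<lambda>i. 1)"
    unfolding two_diag_def mat_diag_diag using assms by (intro arg_cong[of _ _ "mat_diag N"]) auto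
  then show "two_diag N r x y * two_diag N r (inverse x) (inverse y) = 1\<^sub>m N" by simp
qed auto

lemma det_two_diag: "r \<le> N \<Longrightarrow> det (two_diag N r x y) = x ^ r * y ^ (N - r)" for x :: "'a::comm_ring_1"
  by (simp add: two_diag_def det_mat_diag prod_step_fun)

lemma const_mat_two_diag: "const_mat (two_diag N r x y) = two_diag N r (fls_const x) (fls_const y)"
  by (rule eq_matI) (auto simp: two_diag_index const_mat_def)

lemma coeff0_two_diag: "coeff0 (two_diag N r x y) = two_diag N r (fls_nth x 0) (fls_nth y 0)"
  by (rule eq_matI) (auto simp: two_diag_index coeff0_def)

lemma blkB_two_diag: "blkB N r (two_diag N r x y) = 0\<^sub>m r (N - r)"
  by (rule eq_matI) (auto simp: blkB_def two_diag_index)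

lemma det_blkD_two_diag: "det (blkD N r (two_diag N r x y)) = y ^ (N - r)" for x :: "'a::comm_ring_1"
proof -
  have "blkD N r (two_diag N r x y) = two_diag (N - r) 0 y y"
    by (rule eq_matI) (auto simp: blkD_def two_diag_index)
  then show ?thesis by (simp add: det_two_diag)
qed

text \<open>The upper scalar recurrence with \<alpha> = 1, started so that its first new iterate is
  \<open>M / X\<close>. The polynomials \<open>p\<close> and \<open>q\<close> are the nontrivial
  factors of the numerators of \<open>x2\<close> and \<open>x3\<close>; the claims are the iterates
  with denominators cleared.\<close>

lemma scalar_orbit:
  fixes X M :: "'a::field"
  assumes nz: "X \<noteq> 0" "M \<noteq> 0"
  defines "p \<equiv> X\<^sup>2 - M\<^sup>2 - M * X"
  defines "q \<equiv> M\<^sup>2 * (M + 3) + M * X - X\<^sup>2"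
  assumes pq: "p \<noteq> 0" "q \<noteq> 0"
  defines "x1 \<equiv> M / X"
  defines "x2 \<equiv> (M + 1) * inverse x1 - X - x1 - 1"
  defines "x3 \<equiv> (M + 2) * inverse x2 - x1 - x2 - 1"
  defines "x4 \<equiv> (M + 3) * inverse x3 - x2 - x3 - 1"
  shows "x2 * (M * X) = p" "x3 * (M * p) = X * q"
    "x4 * (p * q) = M * (M + 2) * (X * (p - q) - M * p)"
proof -
  show x2: "x2 * (M * X) = p"
    unfolding x2_def x1_def p_def using nz by (simp add: field_simps power2_eq_square)
  then have "x2 = p / (M * X)" using nz by (simp add: nonzero_eq_divide_eq)
  then have i2: "inverse x2 = M * X / p" by simp
  \<comment> \<open>The scalar form of the telescoping: \<open>x1 + x2 + 1\<close> equals
    \<open>(M + 1) * inverse x1 - X\<close>, that is \<open>X / M\<close>. The same device is used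
    for \<open>x4\<close> below.\<close>
  have x3': "x3 = (M + 2) * (M * X / p) - X / M"
  proof -
    have "x3 = (M + 2) * inverse x2 - (x1 + x2 + 1)" by (simp add: x3_def)
    also have "x1 + x2 + 1 = X / M" unfolding x2_def x1_def using nz by (simp add: field_simps)
    finally show ?thesis by (simp add: i2)
  qed
  show x3: "x3 * (M * p) = X * q"
  proof -
    have "x3 * (M * p) = (M + 2) * M * M * X - X * p"
      unfolding x3' using nz pq by (simp add: field_simps)
    also have "\<dots> = X * q" unfolding p_def q_def by (simp add: algebra_simps power2_eq_square)
    finally show ?thesis .
  qed
  then have "x3 = X * q / (M * p)" using nz pq by (simp add: nonzero_eq_divide_eq)
  then have i3: "inverse x3 = M * p / (X * q)" by simp
  have "x4 = (M + 3) * (M * p / (X * q)) - (M + 2) * (M * X / p) + M / X"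
    unfolding x4_def i3 by (subst x3_def) (simp add: i2 x1_def)
  then have "x4 * (p * q) * X = (M + 3) * M * p * p - (M + 2) * M * X * X * q + M * p * q"
    using nz pq by (simp add: field_simps)
  also have "\<dots> = M * p * ((M + 3) * p + q) - (M + 2) * M * X * X * q"
    by (simp add: algebra_simps)
  \<comment> \<open>This divisibility by \<open>X\<close> is confinement in the scalar case: it
    cancels the factor \<open>X\<close> in the denominator of \<open>x4\<close>.\<close>
  also have "(M + 3) * p + q = (M + 2) * X * (X - M)"
    unfolding p_def q_def by (simp add: algebra_simps power2_eq_square)
  also have "M * p * ((M + 2) * X * (X - M)) - (M + 2) * M * X * X * q = M * (M + 2) * (X * (p - q) - M * p) * X"
    by (simp add: algebra_simps)
  finally show "x4 * (p * q) = M * (M + 2) * (X * (p - q) - M * p)" using nz by simp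
qed

section \<open>The parameter set of the genericity claim\<close>

definition nondegenerate :: "nat \<Rightarrow> nat \<Rightarrow> nat \<Rightarrow> complex mat \<Rightarrow> complex fls mat \<Rightarrow> complex fls mat \<Rightarrow> bool" where
  "nondegenerate N r m \<alpha> b0 b1 \<longleftrightarrow> admissible N r \<alpha> b0 b1 \<and>
     (let Cm = blkC N r (coeff0 (beta \<alpha> b0 b1 m m));
          Dm = blkD N r (coeff0 (beta \<alpha> b0 b1 m m));
          Z1 = blkD N r (coeff0 (beta \<alpha> b0 b1 m (m+1)))
               + minv Dm * Cm * blkB N r (coeff0 (beta \<alpha> b0 b1 m (m+1)));
          Z2 = blkD N r (coeff0 (beta \<alpha> b0 b1 m (m+2)))
               + minv Dm * Cm * blkB N r (coeff0 (beta \<alpha> b0 b1 m (m+2)));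
          Z3 = blkD N r (coeff0 (beta \<alpha> b0 b1 m (m+3)))
      in det Dm \<noteq> 0 \<and> det Z1 \<noteq> 0 \<and> det Z2 \<noteq> 0 \<and> det Z3 \<noteq> 0)"

text \<open>On this set the determinants that the recurrence inverts have constant exact orders,
  which is the condition for inverting uniformly in the parameters.\<close>

lemma nondegenerate_orders:
  assumes "r \<le> N" "m \<ge> 1" "nondegenerate N r m \<alpha> b0 b1"
  shows "exact_order (det (beta \<alpha> b0 b1 m m)) (int r)"
    "exact_order (det (beta \<alpha> b0 b1 m (m+1))) (- int r)"
    "exact_order (det (beta \<alpha> b0 b1 m (m+2))) (- int r)"
    "exact_order (det (beta \<alpha> b0 b1 m (m+3))) (int r)"
    "order_ge 0 (det (beta \<alpha> b0 b1 m (m+4)))"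
proof -
  have ad: "admissible N r \<alpha> b0 b1" using assms(3) by (simp add: nondegenerate_def)
  note z = assms(3)[unfolded nondegenerate_def Let_def beta_initial[OF assms(2)]]
  have z: "det (blkD N r (coeff0 b1)) \<noteq> 0"
    "det (blkD N r (coeff0 (beta \<alpha> b0 b1 m (m+1)))
      + minv (blkD N r (coeff0 b1)) * blkC N r (coeff0 b1) * blkB N r (coeff0 (beta \<alpha> b0 b1 m (m+1)))) \<noteq> 0"
    "det (blkD N r (coeff0 (beta \<alpha> b0 b1 m (m+2)))
      + minv (blkD N r (coeff0 b1)) * blkC N r (coeff0 b1) * blkB N r (coeff0 (beta \<alpha> b0 b1 m (m+2)))) \<noteq> 0"
    "det (blkD N r (coeff0 (beta \<alpha> b0 b1 m (m+3)))) \<noteq> 0"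
    using z by blast+
  note c = beta_confinement[OF assms(1,2) ad z(1)]
  show "exact_order (det (beta \<alpha> b0 b1 m m)) (int r)"
    using ad beta_initial[OF assms(2)] by (simp add: admissible_def)
  show "exact_order (det (beta \<alpha> b0 b1 m (m+1))) (- int r)"
    "exact_order (det (beta \<alpha> b0 b1 m (m+2))) (- int r)"
    "exact_order (det (beta \<alpha> b0 b1 m (m+3))) (int r)"
    "order_ge 0 (det (beta \<alpha> b0 b1 m (m+4)))"
    using c(1) c(2)[OF z(2)] c(3)[OF z(2,3)] c(4)[OF z(2,3,4)] z by blast+
qed

text \<open>The initial coefficients are coordinates, hence rational; each of the four recurrence
  steps preserves rationality because the determinant being inverted has the same exact order at
  every point of \<open>S\<close>.\<close>

lemma beta_rational:
  fixes N r m :: nat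
  assumes r: "r \<le> N" and m: "m \<ge> 1"
  defines "S \<equiv> {(\<alpha>, b0, b1). nondegenerate N r m \<alpha> b0 b1}"
    and "\<pi> \<equiv> \<lambda>(\<alpha>, b0, b1). param N \<alpha> b0 b1"
    and "B \<equiv> \<lambda>k (\<alpha>, b0, b1). beta \<alpha> b0 b1 m (m + k)"
  shows "rational_series S \<pi> (\<lambda>s. det (B 4 s))"
proof -
  have ad: "admissible N r (fst s) (fst (snd s)) (snd (snd s))" if "s \<in> S" for s
    using that by (auto simp: S_def nondegenerate_def)
  have ps: "fls_nth (fst (snd s) $$ (i,j)) k = 0 \<and> fls_nth (snd (snd s) $$ (i,j)) k = 0"
    if "s \<in> S" "i < N" "j < N" "k < 0" for s i j k
    using ad[OF that(1)] that by (auto simp: admissible_def is_power_series_def)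
  have v: "rational_on S \<pi> (\<lambda>s. \<pi> s v)" for v
    using rational_on_polyfun[OF polyfun_var] .
  have a: "rational_mat S \<pi> N (\<lambda>s. const_mat (fst s))"
  proof (rule rational_matI)
    fix i j assume ij: "i < N" "j < N"
    have e: "const_mat (fst s) $$ (i,j) = fls_const (\<pi> s (Alpha i j))" if "s \<in> S" for s
      using ad[OF that] ij by (auto simp: admissible_def const_mat_def \<pi>_def param_def split: prod.splits)
    have "rational_series S \<pi> (\<lambda>s. fls_const (\<pi> s (Alpha i j)))"
    proof (rule rational_seriesI)
      show "rational_on S \<pi> (\<lambda>s. fls_nth (fls_const (\<pi> s (Alpha i j))) k)" for k
        using v[of "Alpha i j"] by (cases "k = 0") auto
    qed (rule order_ge_const)
    then show "rational_series S \<pi> (\<lambda>s. const_mat (fst s) $$ (i,j))"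
      by (rule rational_series_cong) (simp add: e)
  qed (use ad in \<open>auto simp: admissible_def\<close>)
  \<comment> \<open>A power series whose coefficients are themselves coordinates; \<open>g k\<close>
    names the coordinate holding coefficient \<open>k\<close>.\<close>
  have series: "rational_series S \<pi> f"
    if f: "\<And>s k. s \<in> S \<Longrightarrow> k < 0 \<Longrightarrow> fls_nth (f s) k = 0"
      and g: "\<And>s k. s \<in> S \<Longrightarrow> fls_nth (f s) (int k) = \<pi> s (g k)" for f g
  proof (rule rational_seriesI)
    show "rational_on S \<pi> (\<lambda>s. fls_nth (f s) k)" for k
    proof (cases "k < 0")
      case True
      then show ?thesis by (intro rational_on_cong[OF rational_on_const[of S \<pi> 0]]) (simp add: f)
    next
      case False
      then show ?thesis
        by (intro rational_on_cong[OF v[of "g (nat k)"]]) (simp flip: g)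
    qed
  qed (use f in \<open>auto simp: order_ge_def\<close>)
  have b0: "rational_mat S \<pi> N (\<lambda>s. fst (snd s))"
  proof (rule rational_matI)
    fix i j assume ij: "i < N" "j < N"
    then show "rational_series S \<pi> (\<lambda>s. fst (snd s) $$ (i,j))"
      using ps[OF _ ij] by (intro series[of _ "B0 i j"]) (auto simp: \<pi>_def param_def split: prod.splits)
  qed (use ad in \<open>auto simp: admissible_def\<close>)
  have b1: "rational_mat S \<pi> N (\<lambda>s. snd (snd s))"
  proof (rule rational_matI)
    fix i j assume ij: "i < N" "j < N"
    then show "rational_series S \<pi> (\<lambda>s. snd (snd s) $$ (i,j))"
      using ps[OF _ ij] by (intro series[of _ "B1 i j"]) (auto simp: \<pi>_def param_def split: prod.splits)
  qed (use ad in \<open>auto simp: admissible_def\<close>)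
  have BS: "B k s = beta (fst s) (fst (snd s)) (snd (snd s)) m (m + k)" for k s
    by (simp add: B_def split: prod.splits)
  have nd: "nondegenerate N r m (fst s) (fst (snd s)) (snd (snd s))" if "s \<in> S" for s
    using that by (auto simp: S_def)
  note ord = nondegenerate_orders[OF r m nd]
  have B0: "B 0 = (\<lambda>s. snd (snd s))" by (auto simp: BS beta_initial[OF m])
  have R0: "rational_mat S \<pi> N (B 0)" unfolding B0 by (rule b1)
  have B1: "B 1 = (\<lambda>s. of_nat m \<cdot>\<^sub>m minv (B 0 s) - fst (snd s) - B 0 s - const_mat (fst s))"
    by (rule ext) (simp add: BS beta_first[OF m, simplified] beta_initial[OF m])
  have Bs: "B (k + 2) = (\<lambda>s. of_nat (m + k + 1) \<cdot>\<^sub>m minv (B (k + 1) s) - B k s - B (k + 1) s - const_mat (fst s))" for k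
    by (rule ext) (use beta_step[OF m] in \<open>simp only: BS add.assoc\<close>)
  have R1: "rational_mat S \<pi> N (B 1)"
    unfolding B1
    by (intro rational_mat_diff rational_mat_smult rational_series_const rational_mat_minv[of _ _ _ _ "int r"] R0 b0 a)
      (use ord(1) in \<open>simp add: BS\<close>)
  have step: "rational_mat S \<pi> N (B (k + 2))"
    if "rational_mat S \<pi> N (B k)" "rational_mat S \<pi> N (B (k + 1))"
      and "\<And>s. s \<in> S \<Longrightarrow> exact_order (det (B (k + 1) s)) e" for k e
    unfolding Bs
    by (intro rational_mat_diff rational_mat_smult rational_series_const rational_mat_minv[of _ _ _ _ e] that a)
  have R2: "rational_mat S \<pi> N (B 2)" using step[of 0 "- int r"] R0 R1 ord(2) by (simp add: BS numeral_2_eq_2)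
  have R3: "rational_mat S \<pi> N (B 3)" using step[of 1 "- int r"] R1 R2 ord(3) by (simp add: BS numeral_eq_Suc)
  have R4: "rational_mat S \<pi> N (B 4)" using step[of 2 "int r"] R2 R3 ord(4) by (simp add: BS numeral_eq_Suc)
  show ?thesis by (rule rational_mat_det[OF R4])
qed

lemma exact_order_mult: "exact_order x k \<Longrightarrow> exact_order y l \<Longrightarrow> exact_order (x * y) (k + l)"
  by (simp add: exact_order_def)

lemma exact_order_power: "exact_order x 0 \<Longrightarrow> exact_order (x ^ n) 0"
  by (simp add: exact_order_def fls_subdegree_pow)

section \<open>The explicit nondegenerate orbit\<close>

text \<open>All three are polynomials in \<epsilon>, so nonzero values at \<epsilon> = 0 suffice:
  these are -m^2, m^2 (m+3) and m^4 (m+2).\<close>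

lemma exact_order_witness:
  fixes m :: nat
  assumes m: "m \<ge> 1"
  defines "X \<equiv> fls_X :: complex fls" and "M \<equiv> of_nat m :: complex fls"
  defines "p \<equiv> X\<^sup>2 - M\<^sup>2 - M * X"
  defines "q \<equiv> M\<^sup>2 * (M + 3) + M * X - X\<^sup>2"
  shows "exact_order p 0" "exact_order q 0" "exact_order (M * (M + 2) * (X * (p - q) - M * p)) 0"
proof -
  have p: "p = X ^ 2 - of_nat (m ^ 2) - of_nat m * X" by (simp add: p_def M_def)
  have q: "q = of_nat (m ^ 2 * (m + 3)) + of_nat m * X - X ^ 2" by (simp add: q_def M_def)
  show op: "exact_order p 0"
    unfolding exact_order_iff p order_ge_def X_def using m
    by (simp add: fls_of_nat_nth fls_X_power_nth del: of_nat_power of_nat_mult of_nat_add)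
  show oq: "exact_order q 0"
    unfolding exact_order_iff q order_ge_def X_def using m
    by (simp add: fls_of_nat_nth fls_X_power_nth del: of_nat_power of_nat_mult of_nat_add)
  have "exact_order (X * (p - q) - of_nat m * p) 0"
    using op oq m unfolding exact_order_iff order_ge_def X_def
    by (simp add: fls_X_times_conv_shift)
  moreover have "exact_order (of_nat (m * (m + 2)) :: complex fls) 0"
    unfolding exact_order_iff order_ge_def using m by (simp add: fls_of_nat_nth del: of_nat_mult of_nat_add)
  moreover have "M * (M + 2) = of_nat (m * (m + 2))" by (simp add: M_def algebra_simps)
  ultimately show "exact_order (M * (M + 2) * (X * (p - q) - M * p)) 0"
    using exact_order_mult[of "of_nat (m * (m + 2))" 0 "X * (p - q) - M * p" 0] unfolding M_def by simp
qed

lemma nondegenerate_witness: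
  assumes r: "r \<le> N" and m: "m \<ge> 1"
  obtains \<alpha> b0 b1 where "nondegenerate N r m \<alpha> b0 b1"
    "exact_order (det (beta \<alpha> b0 b1 m (m + 4))) 0"
proof -
  define X where "X = (fls_X :: complex fls)"
  define M where "M = (of_nat m :: complex fls)"
  have nz: "X \<noteq> 0" "M \<noteq> 0" using m by (auto simp: X_def M_def)
  define p where "p = X\<^sup>2 - M\<^sup>2 - M * X"
  define q where "q = M\<^sup>2 * (M + 3) + M * X - X\<^sup>2"
  note ord = exact_order_witness[OF m, folded X_def M_def, folded p_def q_def]
  have pq: "p \<noteq> 0" "q \<noteq> 0" using ord by (auto simp: exact_order_def)
  define x1 where "x1 = M / X"
  define x2 where "x2 = (M + 1) * inverse x1 - X - x1 - 1"
  define x3 where "x3 = (M + 2) * inverse x2 - x1 - x2 - 1"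
  define x4 where "x4 = (M + 3) * inverse x3 - x2 - x3 - 1"
  note orbit = scalar_orbit[OF nz, folded p_def q_def, OF pq, folded x1_def, folded x2_def, folded x3_def, folded x4_def]
  have x1: "x1 \<noteq> 0" using nz by (simp add: x1_def)
  have x2: "x2 \<noteq> 0" using orbit(1) pq by auto
  have x3: "x3 \<noteq> 0" using orbit(2) pq nz by auto
  have "x4 \<noteq> 0" using orbit(3) ord(3) by (auto simp: exact_order_def)
  then have x4: "exact_order x4 0"
    using ord orbit(3) fls_subdegree_mult[of x4 "p * q"] pq by (simp add: exact_order_def)
  \<comment> \<open>The upper entries are those of \<open>scalar_orbit\<close>: with
    \<open>-1 - X\<close> before \<open>X\<close>, the next one is \<open>M / X\<close>. The lower
    entries are chosen so that the orbit 1, m+1, m+2, 1, 2m+3 never vanishes and has no \<epsilon>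
    dependence.\<close>
  define \<alpha> where "\<alpha> = two_diag N r 1 (- (2 * of_nat m + 3) :: complex)"
  define b0 where "b0 = two_diag N r (- 1 - X) (2 * M + 1)"
  define b1 where "b1 = two_diag N r X 1"
  have al: "const_mat \<alpha> = two_diag N r 1 (- (2 * M + 3))"
    unfolding \<alpha>_def const_mat_two_diag M_def fls_of_nat
    by (rule arg_cong2[of _ _ _ _ "two_diag N r"]) (auto intro!: fls_eqI simp: fls_of_nat_nth)
  have Mn: "M + 1 \<noteq> 0" "M + 2 \<noteq> 0"
    unfolding M_def by (metis of_nat_Suc of_nat_eq_0_iff nat.simps(3) add.commute, metis of_nat_add of_nat_numeral of_nat_eq_0_iff add_is_0 zero_neq_numeral)
  note s = two_diag_diff two_diag_smult two_diag_minv
  have of_nat: "of_nat (m + 1) = M + 1" "of_nat (m + 2) = M + 2" "of_nat (m + 3) = M + 3"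
    by (simp_all add: M_def)
  have inv: "(M + 1) * inverse (M + 1) = 1" "(M + 2) * inverse (M + 2) = 1"
    using Mn by (simp_all add: right_inverse)
  let ?B = "\<lambda>k. beta \<alpha> b0 b1 m (m + k)"
  have B0: "?B 0 = two_diag N r X 1" using beta_initial[OF m] by (simp add: b1_def)
  have B1: "?B 1 = two_diag N r x1 (M + 1)"
    unfolding beta_first[OF m] al b0_def b1_def
    using nz by (simp add: s x1_def divide_inverse flip: M_def)
  have "?B 2 = of_nat (m + 1) \<cdot>\<^sub>m minv (?B 1) - ?B 0 - ?B 1 - const_mat \<alpha>"
    using beta_step[OF m, of \<alpha> b0 b1 0] by simp
  then have B2: "?B 2 = two_diag N r x2 (M + 2)"
    unfolding B0 B1 al of_nat two_diag_minv[OF x1 Mn(1)] two_diag_smult inv two_diag_diff x2_def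
    by (simp add: algebra_simps)
  have "?B 3 = of_nat (m + 2) \<cdot>\<^sub>m minv (?B 2) - ?B 1 - ?B 2 - const_mat \<alpha>"
    using beta_step[OF m, of \<alpha> b0 b1 1] by (simp add: numeral_eq_Suc)
  then have B3: "?B 3 = two_diag N r x3 1"
    unfolding B1 B2 al of_nat two_diag_minv[OF x2 Mn(2)] two_diag_smult inv two_diag_diff x3_def
    by (simp add: algebra_simps)
  have "?B 4 = of_nat (m + 3) \<cdot>\<^sub>m minv (?B 3) - ?B 2 - ?B 3 - const_mat \<alpha>"
    using beta_step[OF m, of \<alpha> b0 b1 2] by (simp add: numeral_eq_Suc)
  then have B4: "?B 4 = two_diag N r x4 (2 * M + 3)"
    unfolding B2 B3 al of_nat two_diag_minv[OF x3 one_neq_zero] two_diag_smult inv two_diag_diff x4_def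
    by (simp add: algebra_simps)
  show ?thesis
  proof (rule that)
    have "exact_order (det b1) (int r)"
      using r by (simp add: b1_def det_two_diag exact_order_def X_def fls_subdegree_pow)
    then have "admissible N r \<alpha> b0 b1"
      unfolding admissible_def using r
      by (auto simp: \<alpha>_def b0_def b1_def two_diag_index is_power_series_def X_def M_def fls_of_nat_nth)
    \<comment> \<open>Off-diagonal blocks vanish along the orbit, so the shear corrections are zero
      and the three determinants are powers of the lower entries m+1, m+2 and 1.\<close>
    moreover have "u * blkB N r (coeff0 (two_diag N r x y)) = 0\<^sub>m (N - r) (N - r)"
      if "u \<in> carrier_mat (N - r) r" for u and x y :: "complex fls"
      using that by (simp add: coeff0_two_diag blkB_two_diag)
    moreover have "minv (blkD N r X) * blkC N r X \<in> carrier_mat (N - r) r" for X :: "complex mat"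
      by (rule mult_carrier_mat[of _ _ "N - r"]) auto
    moreover have "det (blkD N r (coeff0 (two_diag N r x y)) + 0\<^sub>m (N - r) (N - r)) = fls_nth y 0 ^ (N - r)"
      "det (blkD N r (coeff0 (two_diag N r x y))) = fls_nth y 0 ^ (N - r)" for x y :: "complex fls"
      by (simp_all add: coeff0_two_diag det_blkD_two_diag right_add_zero_mat[OF blk_carrier(4)])
    moreover have "fls_nth (M + 1) 0 \<noteq> 0" "fls_nth (M + 2) 0 \<noteq> 0"
      using of_nat_neq_0[of m, where 'a = complex] of_nat_neq_0[of "Suc m", where 'a = complex]
      by (simp_all add: M_def fls_of_nat_nth add.commute)
    ultimately show "nondegenerate N r m \<alpha> b0 b1"
      unfolding nondegenerate_def Let_def using B0 B1 B2 B3 by simp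
    have "exact_order (of_nat (2 * m + 3) :: complex fls) 0"
      unfolding exact_order_iff order_ge_def by (simp add: fls_of_nat_nth del: of_nat_mult of_nat_add)
    then have "exact_order (2 * M + 3) 0" by (simp add: M_def)
    then show "exact_order (det (beta \<alpha> b0 b1 m (m + 4))) 0"
      using exact_order_mult[OF exact_order_power[OF x4, of r] exact_order_power, of "2 * M + 3" "N - r"] r
      unfolding B4 by (simp add: det_two_diag)
  qed
qed

section \<open>The theorem\<close>

text \<open>Genericity is expressed by one polynomial \<open>P\<close> in finitely many coordinates,
  depending only on \<open>N\<close>, \<open>r\<close> and \<open>m\<close>: it is nonzero somewhere
  on the parameter set, and the claim holds wherever it is nonzero.\<close>

theorem theorem2:
  fixes N r m :: nat
  assumes "N \<ge> 2" and "1 \<le> r" and "r \<le> N - 1" and "m \<ge> 2"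
  shows
   "(\<forall>\<alpha> b0 b1. admissible N r \<alpha> b0 b1 \<longrightarrow>
      (let Cm = blkC N r (coeff0 (beta \<alpha> b0 b1 m m));
           Dm = blkD N r (coeff0 (beta \<alpha> b0 b1 m m));
           Z1 = blkD N r (coeff0 (beta \<alpha> b0 b1 m (m+1)))
                + minv Dm * Cm * blkB N r (coeff0 (beta \<alpha> b0 b1 m (m+1)));
           Z2 = blkD N r (coeff0 (beta \<alpha> b0 b1 m (m+2)))
                + minv Dm * Cm * blkB N r (coeff0 (beta \<alpha> b0 b1 m (m+2)));
           Z3 = blkD N r (coeff0 (beta \<alpha> b0 b1 m (m+3)))
       in (det Dm \<noteq> 0 \<longrightarrow>
             (exact_order (det (beta \<alpha> b0 b1 m (m+1))) (- int r) \<longleftrightarrow> det Z1 \<noteq> 0))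
        \<and> (det Dm \<noteq> 0 \<and> det Z1 \<noteq> 0 \<longrightarrow>
             (exact_order (det (beta \<alpha> b0 b1 m (m+2))) (- int r) \<longleftrightarrow> det Z2 \<noteq> 0))
        \<and> (det Dm \<noteq> 0 \<and> det Z1 \<noteq> 0 \<and> det Z2 \<noteq> 0 \<longrightarrow>
             (exact_order (det (beta \<alpha> b0 b1 m (m+3))) (int r) \<longleftrightarrow> det Z3 \<noteq> 0))))
    \<and>
    (\<exists>P. polyfun P \<and>
      (let S = {(\<alpha>, b0, b1). admissible N r \<alpha> b0 b1 \<and>
          (let Cm = blkC N r (coeff0 (beta \<alpha> b0 b1 m m));
               Dm = blkD N r (coeff0 (beta \<alpha> b0 b1 m m));
               Z1 = blkD N r (coeff0 (beta \<alpha> b0 b1 m (m+1)))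
                    + minv Dm * Cm * blkB N r (coeff0 (beta \<alpha> b0 b1 m (m+1)));
               Z2 = blkD N r (coeff0 (beta \<alpha> b0 b1 m (m+2)))
                    + minv Dm * Cm * blkB N r (coeff0 (beta \<alpha> b0 b1 m (m+2)));
               Z3 = blkD N r (coeff0 (beta \<alpha> b0 b1 m (m+3)))
           in det Dm \<noteq> 0 \<and> det Z1 \<noteq> 0 \<and> det Z2 \<noteq> 0 \<and> det Z3 \<noteq> 0)}
       in (\<exists>(\<alpha>, b0, b1)\<in>S. P (param N \<alpha> b0 b1) \<noteq> 0) \<and>
          (\<forall>(\<alpha>, b0, b1)\<in>S. P (param N \<alpha> b0 b1) \<noteq> 0 \<longrightarrow>
             exact_order (det (beta \<alpha> b0 b1 m (m+4))) 0)))"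
proof (rule conjI, goal_cases)
  have r: "r \<le> N" and m: "m \<ge> 1" using assms by auto
  {
    case 1
    show ?case
      unfolding Let_def beta_initial[OF m]
      using beta_confinement(1,2,3)[OF r m] by blast
  next
    case 2
    let ?S = "{(\<alpha>, b0, b1). nondegenerate N r m \<alpha> b0 b1}"
    let ?\<pi> = "\<lambda>(\<alpha>, b0, b1). param N \<alpha> b0 b1"
    let ?f = "\<lambda>(\<alpha>, b0, b1). fls_nth (det (beta \<alpha> b0 b1 m (m + 4))) 0"
    have "rational_on ?S ?\<pi> ?f"
      using rational_seriesD[OF beta_rational[OF r m], of 0] by (simp add: case_prod_unfold)
    \<comment> \<open>The numerator \<open>P\<close> of the constant term of the determinant is the
      required polynomial; its zero set is the exceptional variety.\<close>
    then obtain P Q where P: "polyfun P"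
      and PQ: "\<forall>s\<in>?S. Q (?\<pi> s) \<noteq> 0 \<and> ?f s * Q (?\<pi> s) = P (?\<pi> s)"
      unfolding rational_on_def by blast
    have eq: "fls_nth (det (beta \<alpha> b0 b1 m (m + 4))) 0 \<noteq> 0 \<longleftrightarrow> P (param N \<alpha> b0 b1) \<noteq> 0"
      if "nondegenerate N r m \<alpha> b0 b1" for \<alpha> b0 b1
      using PQ[rule_format, of "(\<alpha>, b0, b1)"] that by force
    obtain \<alpha>0 b00 b10 where w: "nondegenerate N r m \<alpha>0 b00 b10"
      "exact_order (det (beta \<alpha>0 b00 b10 m (m + 4))) 0"
      by (rule nondegenerate_witness[OF r m], rule that)
    have "\<exists>(\<alpha>, b0, b1)\<in>?S. P (param N \<alpha> b0 b1) \<noteq> 0"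
      using w eq[OF w(1)] by (intro bexI[of _ "(\<alpha>0, b00, b10)"]) (simp_all add: exact_order_iff)
    moreover have "\<forall>(\<alpha>, b0, b1)\<in>?S. P (param N \<alpha> b0 b1) \<noteq> 0 \<longrightarrow>
        exact_order (det (beta \<alpha> b0 b1 m (m + 4))) 0"
      \<comment> \<open>The determinant has no pole anywhere on the set, so exact order 0 means only
        that its constant term is nonzero.\<close>
      using eq nondegenerate_orders(5)[OF r m] by (auto simp: exact_order_iff)
    ultimately show ?case
      using P unfolding nondegenerate_def Let_def by (intro exI[of _ P]) (rule conjI, assumption, rule conjI)
  }
qed

end
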